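(* There exists a function $F:\mathbb{S}\to\mathcal{O}(\mathbb{B})$ that is Markov-computable but not K-computable.
   Context: $\mathbb{S}=\{\bot,\top\}$ is the Sierpiński space with topology $\{\emptyset,\{\top\},\mathbb{S}\}$, viewed as an effective topological space with basis $\{\mathbb{S},\{\top\}\}$; both points are computable. A Type-2 name of a point is a $p\in\mathbb{N}^{\mathbb{N}}$ whose range is the set of indices of basic open sets containing the point; a Markov name is an index $e$ of a total computable Type-2 name $\varphi_e$; $K(s)$ is the length of a shortest program computing a Type-2 name of $s$; a K-name of $s$ is a pair $(k,p)$ with $k\geq K(s)$ and $p$ a Type-2 name of $s$. $\mathbb{B}=\mathbb{N}^{\mathbb{N}}$ is Baire space and $\mathcal{O}(\mathbb{B})$ its set of open subsets; an $\mathcal{O}(\mathbb{B})$-name of an open set $U$ is an enumeration (on a one-way output tape) of a set of finite sequences $u$ whose cylinders $[u]$ have union $U$. For R $\in\{$Markov, K$\}$, $F$ is R-computable if there is a Turing machine which, given any R-name of any $s\in\mathbb{S}$, outputs an $\mathcal{O}(\mathbb{B})$-name of $F(s)$. *)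

theory Defs
  imports
    "HOL-Analysis.Function_Topology"
    "HOL-Library.Nat_Bijection"
    "HOL-Library.Extended_Nat"
    "HOL-Library.Discrete_Functions"
begin

text \<open>
  A machine has a one-way read-only input tape over \<open>{0,1}\<close> (\<^typ>\<open>bool\<close>, blank is \<^const>\<open>False\<close>),
  finitely many two-way infinite work tapes, and a one-way write-only output tape over \<open>{0,1}\<close>.
  Work-tape symbols are natural numbers with blank \<open>0\<close>; since the table is finite, only finitely
  many of them occur. A work tape \<open>(l, r)\<close> has the cells left of the head in \<open>l\<close> (nearest first)
  and the scanned cell followed by the cells to its right in \<open>r\<close>; all other cells are blank.
\<close>

datatype move = Stay | Left | Right

type_synonym tape = "nat list \<times> nat list"

text \<open>
  \<open>r_work\<close> holds, for each work tape, the symbol that has to be read, the symbol to be written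
  and the head move.
\<close>

record rule =
  r_state :: nat
  r_input :: bool
  r_work :: "(nat \<times> nat \<times> move) list"
  r_next :: nat
  r_advance :: bool
  r_emit :: "bool option"

record machine =
  n_tapes :: nat
  rules :: "rule list"

record config =
  state :: nat
  pos :: nat
  tapes :: "tape list"
  out :: "bool list"

fun first_sym :: "nat list \<Rightarrow> nat" where
  "first_sym [] = 0"
| "first_sym (x # xs) = x"

fun scanned :: "tape \<Rightarrow> nat" where
  "scanned (l, r) = first_sym r"

fun tape_op :: "nat \<times> nat \<times> move \<Rightarrow> tape \<Rightarrow> tape" where
  "tape_op (a, b, Stay) (l, r) = (l, b # tl r)"
| "tape_op (a, b, Left) (l, r) = (tl l, first_sym l # b # tl r)"
| "tape_op (a, b, Right) (l, r) = (b # l, tl r)"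

definition applicable :: "(nat \<Rightarrow> bool) \<Rightarrow> config \<Rightarrow> rule \<Rightarrow> bool" where
  "applicable inp c r \<longleftrightarrow>
     r_state r = state c \<and> r_input r = inp (pos c) \<and> map fst (r_work r) = map scanned (tapes c)"

definition apply_rule :: "rule \<Rightarrow> config \<Rightarrow> config" where
  "apply_rule r c =
     \<lparr>state = r_next r,
      pos = (if r_advance r then Suc (pos c) else pos c),
      tapes = map2 tape_op (r_work r) (tapes c),
      out = out c @ (case r_emit r of None \<Rightarrow> [] | Some b \<Rightarrow> [b])\<rparr>"

text \<open>Machines are deterministic: the first applicable rule of the table is used.\<close>

definition step :: "machine \<Rightarrow> (nat \<Rightarrow> bool) \<Rightarrow> config \<Rightarrow> config" where
  "step M inp c =
     (case find (applicable inp c) (rules M) of None \<Rightarrow> c | Some r \<Rightarrow> apply_rule r c)"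

definition halted :: "machine \<Rightarrow> (nat \<Rightarrow> bool) \<Rightarrow> config \<Rightarrow> bool" where
  "halted M inp c \<longleftrightarrow> find (applicable inp c) (rules M) = None"

definition init :: "machine \<Rightarrow> config" where
  "init M = \<lparr>state = 0, pos = 0, tapes = replicate (n_tapes M) ([], []), out = []\<rparr>"

definition run :: "machine \<Rightarrow> (nat \<Rightarrow> bool) \<Rightarrow> nat \<Rightarrow> config" where
  "run M inp t = (step M inp ^^ t) (init M)"

text \<open>
  Input tapes: a number \<open>n\<close> is written \<open>1\<^sup>n 0 0 0 \<dots>\<close>, a sequence \<open>p\<close> is written
  \<open>1\<^bsup>p(0)\<^esup> 0 1\<^bsup>p(1)\<^esup> 0 \<dots>\<close>. In the latter the \<open>n\<close>-th separator is in cell \<open>n + (p(0) + \<dots> + p(n))\<close>.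
\<close>

definition nat_input :: "nat \<Rightarrow> nat \<Rightarrow> bool" where
  "nat_input n i \<longleftrightarrow> i < n"

definition seq_input :: "(nat \<Rightarrow> nat) \<Rightarrow> nat \<Rightarrow> bool" where
  "seq_input p i \<longleftrightarrow> \<not> (\<exists>n. i = n + (\<Sum>j\<le>n. p j))"

definition computes :: "machine \<Rightarrow> (nat \<Rightarrow> nat) \<Rightarrow> bool" where
  "computes M p \<longleftrightarrow>
     (\<forall>n. \<exists>t. halted M (nat_input n) (run M (nat_input n) t) \<and>
              out (run M (nat_input n) t) = replicate (p n) True)"

text \<open>
  The numbers listed by an output word \<open>1\<^sup>a 0 1\<^sup>b 0 \<dots>\<close> are \<open>a, b, \<dots>\<close>; an unfinished last block
  does not count. The first argument is the number of \<open>1\<close>s already read in the current block.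
\<close>

fun blocks :: "nat \<Rightarrow> bool list \<Rightarrow> nat list" where
  "blocks c [] = []"
| "blocks c (True # w) = blocks (Suc c) w"
| "blocks c (False # w) = c # blocks 0 w"

text \<open>
  The machine may go on writing forever; it may also list only finitely many numbers, or none.
\<close>

definition enumerates :: "machine \<Rightarrow> (nat \<Rightarrow> bool) \<Rightarrow> nat set" where
  "enumerates M inp = (\<Union>t. set (blocks 0 (out (run M inp t))))"


text \<open>A Goedel numbering of all machines.\<close>

definition decode_move :: "nat \<Rightarrow> move" where
  "decode_move n = (if n = 0 then Stay else if n = 1 then Left else Right)"

definition decode_work :: "nat \<Rightarrow> nat \<times> nat \<times> move" where
  "decode_work n = (let (a, n1) = prod_decode n; (b, d) = prod_decode n1 in (a, b, decode_move d))"

definition decode_emit :: "nat \<Rightarrow> bool option" where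
  "decode_emit n = (if n = 0 then None else Some (n \<noteq> 1))"

definition decode_rule :: "nat \<Rightarrow> rule" where
  "decode_rule n =
     (let (q, n1) = prod_decode n;
          (a, n2) = prod_decode n1;
          (w, n3) = prod_decode n2;
          (q', n4) = prod_decode n3;
          (d, b) = prod_decode n4
      in \<lparr>r_state = q, r_input = (a \<noteq> 0), r_work = map decode_work (list_decode w),
          r_next = q', r_advance = (d \<noteq> 0), r_emit = decode_emit b\<rparr>)"

definition decode_machine :: "nat \<Rightarrow> machine" where
  "decode_machine e =
     (let (k, n) = prod_decode e in \<lparr>n_tapes = k, rules = map decode_rule (list_decode n)\<rparr>)"

lemma surj_map_list_decode:
  assumes "surj f"
  shows "\<exists>n. map f (list_decode n) = xs"
proof -
  have "map f (list_decode (list_encode (map (inv f) xs))) = xs"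
    using assms by (simp add: surj_iff)
  then show ?thesis by blast
qed

lemma surj_decode_move: "surj decode_move"
proof (rule surjI)
  show "decode_move (case m of Stay \<Rightarrow> 0 | Left \<Rightarrow> 1 | Right \<Rightarrow> 2) = m" for m
    by (cases m) (auto simp: decode_move_def)
qed

lemma surj_decode_work: "surj decode_work"
proof -
  have "\<exists>n. decode_work n = (a, b, d)" for a b d
  proof -
    obtain m where "decode_move m = d" using surj_decode_move by (metis surjD)
    then have "decode_work (prod_encode (a, prod_encode (b, m))) = (a, b, d)"
      by (simp add: decode_work_def)
    then show ?thesis by blast
  qed
  then show ?thesis unfolding surj_def by (metis prod_cases3)
qed

lemma surj_decode_emit: "surj decode_emit"
proof (rule surjI)
  show "decode_emit (case x of None \<Rightarrow> 0 | Some b \<Rightarrow> if b then 2 else 1) = x" for x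
    by (auto simp: decode_emit_def split: option.splits)
qed

lemma surj_decode_rule: "surj decode_rule"
proof -
  have "\<exists>n. decode_rule n = r" for r
  proof -
    obtain w where w: "map decode_work (list_decode w) = r_work r"
      using surj_map_list_decode[OF surj_decode_work] by blast
    obtain b where b: "decode_emit b = r_emit r" using surj_decode_emit by (metis surjD)
    have "decode_rule (prod_encode (r_state r, prod_encode (of_bool (r_input r),
            prod_encode (w, prod_encode (r_next r, prod_encode (of_bool (r_advance r), b)))))) = r"
      by (simp add: decode_rule_def w b)
    then show ?thesis by blast
  qed
  then show ?thesis unfolding surj_def by metis
qed

lemma surj_decode_machine: "surj decode_machine"
proof -
  have "\<exists>e. decode_machine e = M" for M
  proof -
    obtain n where n: "map decode_rule (list_decode n) = rules M"
      using surj_map_list_decode[OF surj_decode_rule] by blast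
    have "decode_machine (prod_encode (n_tapes M, n)) = M"
      by (simp add: decode_machine_def n)
    then show ?thesis by blast
  qed
  then show ?thesis unfolding surj_def by metis
qed


datatype sierpinski = Bot | Top

instantiation sierpinski :: topological_space
begin

definition open_sierpinski :: "sierpinski set \<Rightarrow> bool" where
  "open_sierpinski U \<longleftrightarrow> U \<in> {{}, {Top}, UNIV}"

instance
proof
  show "open (UNIV :: sierpinski set)" by (simp add: open_sierpinski_def)
next
  fix S T :: "sierpinski set"
  assume "open S" "open T"
  then show "open (S \<inter> T)" by (auto simp: open_sierpinski_def)
next
  fix K :: "sierpinski set set"
  assume K: "\<forall>S\<in>K. open S"
  show "open (\<Union>K)"
  proof (cases "UNIV \<in> K")
    case True
    then have "\<Union>K = UNIV" by blast
    then show ?thesis by (simp add: open_sierpinski_def)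
  next
    case False
    then have "K \<subseteq> {{}, {Top}}" using K by (auto simp: open_sierpinski_def)
    then have "\<Union>K \<subseteq> {Top}" by blast
    then have "\<Union>K = {} \<or> \<Union>K = {Top}" by (rule subset_singletonD)
    then show ?thesis by (auto simp: open_sierpinski_def)
  qed
qed

end

definition sierpinski_base :: "sierpinski set list" where
  "sierpinski_base = [UNIV, {Top}]"

lemma topological_basis_sierpinski_base: "topological_basis (set sierpinski_base)"
  unfolding topological_basis_def
proof (intro conjI ballI allI impI)
  show "open B" if "B \<in> set sierpinski_base" for B
    using that by (auto simp: sierpinski_base_def open_sierpinski_def)
  show "\<exists>B'\<subseteq>set sierpinski_base. \<Union>B' = U" if "open U" for U
  proof -
    have "U = {} \<or> U = {Top} \<or> U = UNIV" using that by (simp add: open_sierpinski_def)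
    then have "\<Union>{B \<in> set sierpinski_base. B \<subseteq> U} = U"
      by (auto simp: sierpinski_base_def)
    then show ?thesis by (intro exI[of _ "{B \<in> set sierpinski_base. B \<subseteq> U}"]) auto
  qed
qed

definition type2_name :: "(nat \<Rightarrow> nat) \<Rightarrow> sierpinski \<Rightarrow> bool" where
  "type2_name p s \<longleftrightarrow> range p = {i. i < length sierpinski_base \<and> s \<in> sierpinski_base ! i}"

definition markov_name :: "nat \<Rightarrow> sierpinski \<Rightarrow> bool" where
  "markov_name e s \<longleftrightarrow> (\<exists>p. computes (decode_machine e) p \<and> type2_name p s)"

lemma ex_markov_name_Bot: "\<exists>e. markov_name e Bot"
proof -
  obtain e where e: "decode_machine e = \<lparr>n_tapes = 0, rules = []\<rparr>"
    using surj_decode_machine by (metis surjD)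
  have "computes (decode_machine e) (\<lambda>n. 0)"
    unfolding computes_def e
    by (auto simp: halted_def run_def init_def intro!: exI[of _ 0])
  moreover have "type2_name (\<lambda>n. 0) Bot"
    by (auto simp: type2_name_def sierpinski_base_def less_Suc_eq numeral_2_eq_2)
  ultimately show ?thesis unfolding markov_name_def by blast
qed

lemma ex_markov_name_Top: "\<exists>e. markov_name e Top"
proof -
  let ?r = "\<lparr>r_state = 0, r_input = True, r_work = [], r_next = 1,
              r_advance = True, r_emit = Some True\<rparr>"
  let ?p = "\<lambda>n::nat. if n = 0 then 0 else 1::nat"
  obtain e where e: "decode_machine e = \<lparr>n_tapes = 0, rules = [?r]\<rparr>"
    using surj_decode_machine by (metis surjD)
  have "computes (decode_machine e) ?p"
    unfolding computes_def e
    by (auto simp: halted_def run_def init_def step_def applicable_def apply_rule_def nat_input_def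
      intro!: exI[of _ 1])
  moreover have "type2_name ?p Top"
    by (auto simp: type2_name_def sierpinski_base_def less_Suc_eq numeral_2_eq_2 image_iff)
  ultimately show ?thesis unfolding markov_name_def by blast
qed

text \<open>
  Programs are binary words, identified with natural numbers in length-lexicographic order;
  the word number \<open>e\<close> has length \<open>\<lfloor>log\<^sub>2 (e + 1)\<rfloor>\<close>.
\<close>

definition program_length :: "nat \<Rightarrow> nat" where
  "program_length e = floor_log (Suc e)"

definition K :: "sierpinski \<Rightarrow> enat" where
  "K s = (INF e \<in> {e. markov_name e s}. enat (program_length e))"

definition K_name :: "nat \<Rightarrow> (nat \<Rightarrow> nat) \<Rightarrow> sierpinski \<Rightarrow> bool" where
  "K_name k p s \<longleftrightarrow> enat k \<ge> K s \<and> type2_name p s"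


definition cylinder :: "nat list \<Rightarrow> (nat \<Rightarrow> nat) set" where
  "cylinder u = {x. \<forall>i<length u. x i = u ! i}"

definition outputs_open :: "machine \<Rightarrow> (nat \<Rightarrow> bool) \<Rightarrow> (nat \<Rightarrow> nat) set \<Rightarrow> bool" where
  "outputs_open M inp U \<longleftrightarrow> U = (\<Union>c\<in>enumerates M inp. cylinder (list_decode c))"

definition markov_computable :: "(sierpinski \<Rightarrow> (nat \<Rightarrow> nat) set) \<Rightarrow> bool" where
  "markov_computable F \<longleftrightarrow>
     (\<exists>M. \<forall>s e. markov_name e s \<longrightarrow> outputs_open M (nat_input e) (F s))"

text \<open>The name \<open>(k, p)\<close> is given to the machine as the sequence \<open>k, p(0), p(1), \<dots>\<close>.\<close>

definition K_computable :: "(sierpinski \<Rightarrow> (nat \<Rightarrow> nat) set) \<Rightarrow> bool" where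
  "K_computable F \<longleftrightarrow>
     (\<exists>M. \<forall>s k p. K_name k p s \<longrightarrow> outputs_open M (seq_input (case_nat k p)) (F s))"

end

theory Submission
  imports Defs
begin

text \<open>
  Fix for every program \<open>e\<close> the certificates \<open>(n, t)\<close> such that \<open>\<phi>\<^sub>e\<close> has written something on
  input \<open>n\<close> after \<open>t\<close> steps: programs of \<open>Top\<close> have certificates, programs of \<open>Bot\<close> have none.
  Let \<open>F(Bot)\<close> be Baire space, and let \<open>F(Top)\<close> consist of those \<open>y\<close> such that for some \<open>e\<close> that has
  certificates, \<open>y(e)\<close> is not one of them. Given \<open>e\<close>, list the cylinders of all \<open>u\<close> such that
  \<open>u(e)\<close> is not a certificate for \<open>e\<close>; this covers Baire space if \<open>e\<close> names \<open>Bot\<close> and stays inside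
  \<open>F(Top)\<close> if \<open>e\<close> names \<open>Top\<close>. Once a certificate for \<open>e\<close> shows up, list all of \<open>F(Top)\<close>.
  A bound on \<open>K\<close> does not help, since one bound serves both points: a machine that reads
  \<open>(k, 0, 0, \<dots>)\<close> must list a cylinder around a \<open>y\<close> outside \<open>F(Top)\<close> after reading a finite part
  of the name, which is also the beginning of a name of \<open>Top\<close>.

  The listing needs a universal machine, which is obtained by compiling loop programs on registers
  to machines with one unary counter per work tape.
\<close>

section \<open>Loop programs\<close>

datatype com = Skip | Inc nat | Dec nat | Emit bool | Seq com com (infixr ";;" 60)
  | Cond nat com com | For nat com

type_synonym store = "(nat \<Rightarrow> nat) \<times> bool list"

text \<open>
  \<open>For r c\<close> decrements \<open>r\<close> before each of its rounds; \<open>wf_com\<close> below demands that \<open>c\<close> leaves \<open>r\<close>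
  alone, so that this is also the behaviour of a loop that tests \<open>r\<close> in every round.
\<close>

primrec exec :: "com \<Rightarrow> store \<Rightarrow> store" where
  "exec Skip \<sigma> = \<sigma>"
| "exec (Inc r) \<sigma> = ((fst \<sigma>)(r := Suc (fst \<sigma> r)), snd \<sigma>)"
| "exec (Dec r) \<sigma> = ((fst \<sigma>)(r := fst \<sigma> r - 1), snd \<sigma>)"
| "exec (Emit b) \<sigma> = (fst \<sigma>, snd \<sigma> @ [b])"
| "exec (c ;; d) \<sigma> = exec d (exec c \<sigma>)"
| "exec (Cond r c d) \<sigma> = (if fst \<sigma> r = 0 then exec d \<sigma> else exec c \<sigma>)"
| "exec (For r c) \<sigma> = ((\<lambda>\<tau>. exec c ((fst \<tau>)(r := fst \<tau> r - 1), snd \<tau>)) ^^ fst \<sigma> r) \<sigma>"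

primrec regs :: "com \<Rightarrow> nat set" where
  "regs Skip = {}"
| "regs (Inc r) = {r}"
| "regs (Dec r) = {r}"
| "regs (Emit b) = {}"
| "regs (c ;; d) = regs c \<union> regs d"
| "regs (Cond r c d) = insert r (regs c \<union> regs d)"
| "regs (For r c) = insert r (regs c)"

primrec wf_com :: "com \<Rightarrow> bool" where
  "wf_com Skip = True"
| "wf_com (Inc r) = True"
| "wf_com (Dec r) = True"
| "wf_com (Emit b) = True"
| "wf_com (c ;; d) = (wf_com c \<and> wf_com d)"
| "wf_com (Cond r c d) = (wf_com c \<and> wf_com d)"
| "wf_com (For r c) = (wf_com c \<and> r \<notin> regs c)"

lemma exec_other: "r \<notin> regs c \<Longrightarrow> fst (exec c \<sigma>) r = fst \<sigma> r"
proof (induction c arbitrary: \<sigma>)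
  case (For q c)
  have "fst (((\<lambda>\<tau>. exec c ((fst \<tau>)(q := fst \<tau> q - 1), snd \<tau>)) ^^ n) \<sigma>) r = fst \<sigma> r" for n
    by (induction n) (use For in auto)
  then show ?case by simp
qed auto

section \<open>Jump programs and the compiler\<close>

datatype instr = INC nat | DEC nat | EMIT bool | JZ nat nat | JMP nat | READ nat

type_synonym instr_state = "nat \<times> nat \<times> store"

fun instr_regs :: "instr \<Rightarrow> nat set" where
  "instr_regs (INC r) = {r}"
| "instr_regs (DEC r) = {r}"
| "instr_regs (JZ r p) = {r}"
| "instr_regs _ = {}"

fun exec_instr :: "(nat \<Rightarrow> bool) \<Rightarrow> instr \<Rightarrow> instr_state \<Rightarrow> instr_state" where
  "exec_instr inp (INC r) (pc, i, s, w) = (Suc pc, i, s(r := Suc (s r)), w)"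
| "exec_instr inp (DEC r) (pc, i, s, w) = (Suc pc, i, s(r := s r - 1), w)"
| "exec_instr inp (EMIT b) (pc, i, s, w) = (Suc pc, i, s, w @ [b])"
| "exec_instr inp (JZ r p) (pc, i, s, w) = (if s r = 0 then p else Suc pc, i, s, w)"
| "exec_instr inp (JMP p) (pc, i, s, w) = (p, i, s, w)"
| "exec_instr inp (READ p) (pc, i, s, w) = (if inp i then (Suc pc, Suc i, s, w) else (p, i, s, w))"

definition instr_step :: "instr list \<Rightarrow> (nat \<Rightarrow> bool) \<Rightarrow> instr_state \<Rightarrow> instr_state \<Rightarrow> bool" where
  "instr_step P inp a b \<longleftrightarrow> fst a < length P \<and> b = exec_instr inp (P ! fst a) a"

lemma instr_stepI:
  "n < length P \<Longrightarrow> P ! n = ins \<Longrightarrow> exec_instr inp ins (n, x) = b \<Longrightarrow> instr_step P inp (n, x) b"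
  by (simp add: instr_step_def)

text \<open>Jump targets are absolute, so code depends on the address \<open>n\<close> at which it
  is placed.\<close>

primrec compile :: "com \<Rightarrow> nat \<Rightarrow> instr list" where
  "compile Skip n = []"
| "compile (Inc r) n = [INC r]"
| "compile (Dec r) n = [DEC r]"
| "compile (Emit b) n = [EMIT b]"
| "compile (c ;; d) n = compile c n @ compile d (n + length (compile c n))"
| "compile (Cond r c d) n =
     (let C = compile c (n + 1); m = n + 2 + length C; D = compile d m
      in JZ r m # C @ JMP (m + length D) # D)"
| "compile (For r c) n =
     (let C = compile c (n + 2) in JZ r (n + 3 + length C) # DEC r # C @ [JMP n])"

lemma instr_regs_compile: "ins \<in> set (compile c n) \<Longrightarrow> instr_regs ins \<subseteq> regs c"
  by (induction c arbitrary: n) (fastforce simp: Let_def)+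

text \<open>The frames \<open>A\<close> and \<open>B\<close> are arbitrary so that in the induction
  the code surrounding a subprogram can be absorbed into them. Loop programs never read, hence the
  input position \<open>i\<close> stays fixed.\<close>

lemma compile_correct:
  assumes "wf_com c"
  shows "(instr_step (A @ compile c (length A) @ B) inp)\<^sup>*\<^sup>* (length A, i, \<sigma>)
           (length A + length (compile c (length A)), i, exec c \<sigma>)"
  using assms
proof (induction c arbitrary: A B \<sigma>)
  case Skip
  then show ?case by simp
next
  case (Inc r)
  show ?case
    by (cases \<sigma>, rule r_into_rtranclp, rule instr_stepI[where ins = "INC r"]) simp_all
next
  case (Dec r)
  show ?case
    by (cases \<sigma>, rule r_into_rtranclp, rule instr_stepI[where ins = "DEC r"]) simp_all
next
  case (Emit b)
  show ?case
    by (cases \<sigma>, rule r_into_rtranclp, rule instr_stepI[where ins = "EMIT b"]) simp_all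
next
  case (Seq c d)
  let ?C = "compile c (length A)"
  let ?D = "compile d (length (A @ ?C))"
  have "(instr_step (A @ ?C @ (?D @ B)) inp)\<^sup>*\<^sup>* (length A, i, \<sigma>) (length A + length ?C, i, exec c \<sigma>)"
    using Seq.prems by (intro Seq.IH) simp
  also have "(instr_step ((A @ ?C) @ ?D @ B) inp)\<^sup>*\<^sup>* (length (A @ ?C), i, exec c \<sigma>)
      (length (A @ ?C) + length ?D, i, exec d (exec c \<sigma>))"
    using Seq.prems by (intro Seq.IH) simp
  then have "(instr_step (A @ ?C @ (?D @ B)) inp)\<^sup>*\<^sup>* (length A + length ?C, i, exec c \<sigma>)
      (length (A @ ?C) + length ?D, i, exec d (exec c \<sigma>))" by simp
  finally show ?case by (simp add: add.assoc)
next
  case (Cond r c d)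
  obtain s w where \<sigma>: "\<sigma> = (s, w)" by force
  let ?n = "length A"
  let ?C = "compile c (?n + 1)"
  let ?m = "?n + 2 + length ?C"
  let ?D = "compile d ?m"
  let ?P = "A @ (JZ r ?m # ?C @ JMP (?m + length ?D) # ?D) @ B"
  have eq: "A @ compile (Cond r c d) ?n @ B = ?P" by (simp add: Let_def)
  have len: "length (compile (Cond r c d) ?n) = 2 + length ?C + length ?D"
    by (simp add: Let_def)
  show ?case
  proof (cases "s r = 0")
    case True
    have "instr_step ?P inp (?n, i, \<sigma>) (?m, i, \<sigma>)"
      by (rule instr_stepI[where ins = "JZ r ?m"]) (auto simp: nth_append \<sigma> True)
    \<comment> \<open>Everything before the else branch becomes the left frame; its length is
      \<open>?m\<close>, the address for which \<open>d\<close> was compiled.\<close>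
    moreover have "(instr_step ((A @ JZ r ?m # ?C @ [JMP (?m + length ?D)]) @
        compile d (length (A @ JZ r ?m # ?C @ [JMP (?m + length ?D)])) @ B) inp)\<^sup>*\<^sup>*
        (length (A @ JZ r ?m # ?C @ [JMP (?m + length ?D)]), i, \<sigma>)
        (length (A @ JZ r ?m # ?C @ [JMP (?m + length ?D)]) +
         length (compile d (length (A @ JZ r ?m # ?C @ [JMP (?m + length ?D)]))), i, exec d \<sigma>)"
      using Cond.prems by (intro Cond.IH) simp
    then have "(instr_step ?P inp)\<^sup>*\<^sup>* (?m, i, \<sigma>) (?m + length ?D, i, exec d \<sigma>)" by simp
    ultimately have "(instr_step ?P inp)\<^sup>*\<^sup>* (?n, i, \<sigma>) (?m + length ?D, i, exec d \<sigma>)"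
      by (rule converse_rtranclp_into_rtranclp)
    then show ?thesis unfolding eq len using True by (simp add: \<sigma> add_ac)
  next
    case False
    have "instr_step ?P inp (?n, i, \<sigma>) (?n + 1, i, \<sigma>)"
      by (rule instr_stepI[where ins = "JZ r ?m"]) (auto simp: nth_append \<sigma> False)
    moreover have "(instr_step ((A @ [JZ r ?m]) @ compile c (length (A @ [JZ r ?m])) @
        (JMP (?m + length ?D) # ?D @ B)) inp)\<^sup>*\<^sup>* (length (A @ [JZ r ?m]), i, \<sigma>)
        (length (A @ [JZ r ?m]) + length (compile c (length (A @ [JZ r ?m]))), i, exec c \<sigma>)"
      using Cond.prems by (intro Cond.IH) simp
    then have "(instr_step ?P inp)\<^sup>*\<^sup>* (?n + 1, i, \<sigma>) (?n + 1 + length ?C, i, exec c \<sigma>)" by simp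
    moreover have "instr_step ?P inp (?n + 1 + length ?C, i, exec c \<sigma>) (?m + length ?D, i, exec c \<sigma>)"
      by (cases "exec c \<sigma>", rule instr_stepI[where ins = "JMP (?m + length ?D)"])
        (auto simp: nth_append)
    ultimately have "(instr_step ?P inp)\<^sup>*\<^sup>* (?n, i, \<sigma>) (?m + length ?D, i, exec c \<sigma>)"
      by (rule converse_rtranclp_into_rtranclp[OF _ rtranclp.rtrancl_into_rtrancl])
    then show ?thesis unfolding eq len using False by (simp add: \<sigma> add_ac)
  qed
next
  case (For r c)
  let ?n = "length A"
  let ?C = "compile c (?n + 2)"
  let ?m = "?n + 3 + length ?C"
  let ?P = "A @ (JZ r ?m # DEC r # ?C @ [JMP ?n]) @ B"
  let ?f = "\<lambda>\<tau>. exec c ((fst \<tau>)(r := fst \<tau> r - 1), snd \<tau>)"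
  have eq: "A @ compile (For r c) ?n @ B = ?P" by (simp add: Let_def)
  have len: "length (compile (For r c) ?n) = 3 + length ?C"
    by (simp add: Let_def)
  have "(instr_step ?P inp)\<^sup>*\<^sup>* (?n, i, \<tau>) (?m, i, (?f ^^ fst \<tau> r) \<tau>)" for \<tau>
  proof (induction "fst \<tau> r" arbitrary: \<tau>)
    case 0
    have "instr_step ?P inp (?n, i, \<tau>) (?m, i, \<tau>)"
      by (cases \<tau>, rule instr_stepI[where ins = "JZ r ?m"]) (use 0 in \<open>auto simp: nth_append\<close>)
    then show ?case using 0[symmetric] by auto
  next
    case (Suc k)
    let ?\<tau> = "((fst \<tau>)(r := fst \<tau> r - 1), snd \<tau>)"
    have "instr_step ?P inp (?n, i, \<tau>) (?n + 1, i, \<tau>)"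
      by (cases \<tau>, rule instr_stepI[where ins = "JZ r ?m"]) (use Suc(2) in \<open>auto simp: nth_append\<close>)
    moreover have "instr_step ?P inp (?n + 1, i, \<tau>) (?n + 2, i, ?\<tau>)"
      by (cases \<tau>, rule instr_stepI[where ins = "DEC r"]) (auto simp: nth_append)
    moreover have "(instr_step ((A @ [JZ r ?m, DEC r]) @ compile c (length (A @ [JZ r ?m, DEC r])) @
        (JMP ?n # B)) inp)\<^sup>*\<^sup>* (length (A @ [JZ r ?m, DEC r]), i, ?\<tau>)
        (length (A @ [JZ r ?m, DEC r]) + length (compile c (length (A @ [JZ r ?m, DEC r]))), i, exec c ?\<tau>)"
      using For.prems by (intro For.IH) simp
    then have "(instr_step ?P inp)\<^sup>*\<^sup>* (?n + 2, i, ?\<tau>) (?n + 2 + length ?C, i, exec c ?\<tau>)" by simp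
    moreover have "instr_step ?P inp (?n + 2 + length ?C, i, exec c ?\<tau>) (?n, i, exec c ?\<tau>)"
      by (cases "exec c ?\<tau>", rule instr_stepI[where ins = "JMP ?n"]) (auto simp: nth_append)
    \<comment> \<open>The body leaves \<open>r\<close> alone, so the next test sees the decremented
      counter and the inner induction hypothesis covers the remaining rounds.\<close>
    moreover have k: "fst (exec c ?\<tau>) r = k"
      using For.prems Suc(2)[symmetric] by (simp add: exec_other)
    then have "(instr_step ?P inp)\<^sup>*\<^sup>* (?n, i, exec c ?\<tau>) (?m, i, (?f ^^ k) (exec c ?\<tau>))"
      using Suc(1)[of "exec c ?\<tau>"] by (simp only: k)
    ultimately have "(instr_step ?P inp)\<^sup>*\<^sup>* (?n, i, \<tau>) (?m, i, (?f ^^ k) (exec c ?\<tau>))"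
      by (rule converse_rtranclp_into_rtranclp[OF _ converse_rtranclp_into_rtranclp[OF _
            rtranclp_trans[OF _ converse_rtranclp_into_rtranclp]]])
    moreover have "(?f ^^ k) (exec c ?\<tau>) = (?f ^^ fst \<tau> r) \<tau>"
      using Suc(2)[symmetric] by (simp del: funpow.simps add: funpow_Suc_right)
    ultimately show ?case by (simp only:)
  qed
  from this[of \<sigma>] show ?case unfolding eq len by (simp add: add_ac)
qed

section \<open>Turing machines with unary counters\<close>

definition work_ops :: "nat list \<Rightarrow> nat \<Rightarrow> nat \<Rightarrow> move \<Rightarrow> (nat \<times> nat \<times> move) list" where
  "work_ops ws r b d = (map (\<lambda>a. (a, a, Stay)) ws)[r := (ws ! r, b, d)]"

text \<open>
  A rule must specify the symbols scanned on all tapes, hence there is one rule for each word \<open>ws\<close>.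
  Incrementing a nonzero counter takes two steps: the rule moves right, onto a blank, and stays in
  the same state, where the rule for the scanned blank applies.
\<close>

fun rule_of :: "nat \<Rightarrow> instr \<Rightarrow> bool \<Rightarrow> nat list \<Rightarrow> rule" where
  "rule_of pc (INC r) x ws =
     \<lparr>r_state = pc, r_input = x, r_work = work_ops ws r 1 (if ws ! r = 0 then Stay else Right),
      r_next = (if ws ! r = 0 then Suc pc else pc), r_advance = False, r_emit = None\<rparr>"
| "rule_of pc (DEC r) x ws =
     \<lparr>r_state = pc, r_input = x, r_work = work_ops ws r 0 (if ws ! r = 0 then Stay else Left),
      r_next = Suc pc, r_advance = False, r_emit = None\<rparr>"
| "rule_of pc (EMIT b) x ws =
     \<lparr>r_state = pc, r_input = x, r_work = map (\<lambda>a. (a, a, Stay)) ws,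
      r_next = Suc pc, r_advance = False, r_emit = Some b\<rparr>"
| "rule_of pc (JZ r p) x ws =
     \<lparr>r_state = pc, r_input = x, r_work = map (\<lambda>a. (a, a, Stay)) ws,
      r_next = (if ws ! r = 0 then p else Suc pc), r_advance = False, r_emit = None\<rparr>"
| "rule_of pc (JMP p) x ws =
     \<lparr>r_state = pc, r_input = x, r_work = map (\<lambda>a. (a, a, Stay)) ws,
      r_next = p, r_advance = False, r_emit = None\<rparr>"
| "rule_of pc (READ p) x ws =
     \<lparr>r_state = pc, r_input = x, r_work = map (\<lambda>a. (a, a, Stay)) ws,
      r_next = (if x then Suc pc else p), r_advance = x, r_emit = None\<rparr>"

definition machine_of :: "instr list \<Rightarrow> nat \<Rightarrow> machine" where
  "machine_of P k = \<lparr>n_tapes = k, rules =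
     concat (map (\<lambda>pc. concat (map (\<lambda>x. map (rule_of pc (P ! pc) x) (List.n_lists k [0, 1]))
       [False, True])) [0..<length P])\<rparr>"

text \<open>
  The counter \<open>n > 0\<close> is a block of \<open>n\<close> ones with the head on the rightmost one; for \<open>n = 0\<close> the head
  is on a blank. This allows zero tests without head moves.
\<close>

fun counts :: "nat \<Rightarrow> tape \<Rightarrow> bool" where
  "counts n (l, r) \<longleftrightarrow> l = replicate (n - 1) 1 \<and> first_sym r = of_bool (n > 0) \<and> set (tl r) \<subseteq> {0}"

text \<open>Registers from \<open>k\<close> on have no tape; the simulation lemmas therefore demand
  that no instruction mentions them.\<close>

definition represents :: "nat \<Rightarrow> config \<Rightarrow> instr_state \<Rightarrow> bool" where
  "represents k c a \<longleftrightarrow> (case a of (pc, i, s, w) \<Rightarrow> state c = pc \<and> pos c = i \<and> out c = w \<and>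
     length (tapes c) = k \<and> (\<forall>j<k. counts (s j) (tapes c ! j)))"

section \<open>Simulation of instructions by machine steps\<close>

lemma find_unique:
  assumes "x \<in> set xs" "P x" "\<And>y. y \<in> set xs \<Longrightarrow> P y \<Longrightarrow> y = x"
  shows "find P xs = Some x"
proof (cases "find P xs")
  case None
  then show ?thesis using assms(1,2) by (simp add: find_None_iff)
next
  case (Some y)
  then have "y \<in> set xs" "P y" unfolding find_Some_iff by auto
  then show ?thesis using Some assms(3) by simp
qed

lemma fst_work_ops: "map fst (work_ops ws r b d) = ws"
  by (simp add: work_ops_def map_update o_def)

lemma rule_of_sel:
  "r_state (rule_of pc ins x ws) = pc" "r_input (rule_of pc ins x ws) = x"
  "map fst (r_work (rule_of pc ins x ws)) = ws"
  by (cases ins; simp add: fst_work_ops o_def)+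

lemma set_rules_machine_of:
  "set (rules (machine_of P k)) = (\<Union>pc<length P. \<Union>x\<in>{False, True}.
     rule_of pc (P ! pc) x ` {ws. length ws = k \<and> set ws \<subseteq> {0, 1}})"
  by (simp add: machine_of_def set_n_lists atLeast0LessThan)

text \<open>State, input bit and scanned word determine a rule, so exactly one rule of the table
  applies. The words listed in the table are binary, whence the last assumption.\<close>

lemma step_machine_of:
  assumes "state c < length P" "length (tapes c) = k" "set (map scanned (tapes c)) \<subseteq> {0, 1}"
  shows "step (machine_of P k) inp c =
    apply_rule (rule_of (state c) (P ! state c) (inp (pos c)) (map scanned (tapes c))) c"
proof -
  have "find (applicable inp c) (rules (machine_of P k)) =
      Some (rule_of (state c) (P ! state c) (inp (pos c)) (map scanned (tapes c)))"
  proof (rule find_unique)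
    show "rule_of (state c) (P ! state c) (inp (pos c)) (map scanned (tapes c)) \<in> set (rules (machine_of P k))"
      unfolding set_rules_machine_of using assms by (intro UN_I[of "state c"] UN_I[of "inp (pos c)"] imageI) auto
  qed (auto simp: applicable_def rule_of_sel set_rules_machine_of)
  then show ?thesis by (simp add: step_def)
qed

lemma scanned_counts: "counts n T \<Longrightarrow> scanned T = of_bool (n > 0)"
  by (cases T) simp

lemma counts_stay: "counts n T \<Longrightarrow> counts n (tape_op (scanned T, scanned T, Stay) T)"
  by (cases T) simp

lemma first_sym_zeros:
  assumes "set zs \<subseteq> {0::nat}"
  shows "first_sym zs = 0" "set (tl zs) \<subseteq> {0}"
  using assms by (cases zs; auto)+

lemma length_work_ops: "length (work_ops ws r b d) = length ws"
  by (simp add: work_ops_def)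

lemma nth_work_ops:
  "j < length ws \<Longrightarrow> work_ops ws r b d ! j = (if j = r then (ws ! r, b, d) else (ws ! j, ws ! j, Stay))"
  by (simp add: work_ops_def)

text \<open>The step shared by both kinds of increment: the head is on the blank after
  \<open>s r\<close> ones, either because the counter is zero or because a first step has moved
  there. In the latter case tape \<open>r\<close> represents no number, so it is treated separately
  from the other tapes.\<close>

lemma step_INC_blank:
  assumes "state c < length P" "P ! state c = INC r" "length (tapes c) = k" "r < k"
    and others: "\<And>j. j < k \<Longrightarrow> j \<noteq> r \<Longrightarrow> counts (s j) (tapes c ! j)"
    and T: "tapes c ! r = (replicate (s r) 1, zs)" and zs: "first_sym zs = 0" "set (tl zs) \<subseteq> {0}"
  shows "represents k (step (machine_of P k) inp c) (Suc (state c), pos c, s(r := Suc (s r)), out c)"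
proof -
  have "scanned (tapes c ! j) \<in> {0, 1}" if "j < k" for j
    using that others[of j] T zs scanned_counts[of "s j" "tapes c ! j"] by (cases "j = r") auto
  then have "\<forall>T\<in>set (tapes c). scanned T \<in> {0, 1}"
    using assms(3) by (metis in_set_conv_nth)
  then have "set (map scanned (tapes c)) \<subseteq> {0, 1}"
    by (simp add: image_subset_iff)
  note st = step_machine_of[OF assms(1,3) this]
  show ?thesis
    unfolding st using assms(2,3,4) T zs others counts_stay
    by (simp add: represents_def apply_rule_def nth_work_ops length_work_ops)
qed

text \<open>One step suffices except for incrementing a nonzero counter, which takes two. Positivity
  of \<open>t\<close> is recorded because it makes the passes of a loop reach arbitrarily late
  times.\<close>

lemma step_simulates:
  assumes "represents k c (pc, i, s, w)" "pc < length P" "instr_regs (P ! pc) \<subseteq> {..<k}"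
  shows "\<exists>t>0. represents k ((step (machine_of P k) inp ^^ t) c) (exec_instr inp (P ! pc) (pc, i, s, w))"
proof -
  have c: "state c = pc" "pos c = i" "out c = w" "length (tapes c) = k"
    and reps: "\<And>j. j < k \<Longrightarrow> counts (s j) (tapes c ! j)"
    using assms(1) by (auto simp: represents_def)
  have sc: "\<And>j. j < k \<Longrightarrow> scanned (tapes c ! j) = of_bool (s j > 0)"
    using reps scanned_counts by blast
  have "scanned (tapes c ! j) \<in> {0, 1}" if "j < k" for j
    using sc[OF that] by simp
  then have "\<forall>T\<in>set (tapes c). scanned T \<in> {0, 1}"
    using c(4) by (metis in_set_conv_nth)
  then have "set (map scanned (tapes c)) \<subseteq> {0, 1}"
    by (simp add: image_subset_iff)
  with c(4) assms(2) have st: "step (machine_of P k) inp c =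
      apply_rule (rule_of pc (P ! pc) (inp i) (map scanned (tapes c))) c"
    using step_machine_of[of c P k inp] c by simp
  have stay: "counts (s j) (tape_op (Suc 0, Suc 0, Stay) (tapes c ! j))" if "j < k" "s j > 0" for j
    using counts_stay[OF reps] sc that by fastforce
  have stay0: "counts 0 (tape_op (0, 0, Stay) (tapes c ! j))" if "j < k" "s j = 0" for j
    using counts_stay[OF reps] sc that by fastforce
  note simps = represents_def apply_rule_def nth_work_ops length_work_ops c sc reps stay stay0
  have one: ?thesis if "represents k (step (machine_of P k) inp c) (exec_instr inp (P ! pc) (pc, i, s, w))"
    using that by (intro exI[of _ 1]) simp
  show ?thesis
  proof (cases "P ! pc")
    case (INC r)
    then have r: "r < k" using assms(3) by simp
    obtain l zs where T: "tapes c ! r = (l, zs)" by force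
    show ?thesis
    proof (cases "s r = 0")
      case True
      then have "represents k (step (machine_of P k) inp c) (Suc (state c), pos c, s(r := Suc (s r)), out c)"
        using reps[OF r] T INC c r reps assms(2) by (intro step_INC_blank[where zs = zs]) auto
      then show ?thesis using c INC by (intro one) simp
    next
      case False
      let ?c = "step (machine_of P k) inp c"
      have "represents k (step (machine_of P k) inp ?c) (Suc (state ?c), pos ?c, s(r := Suc (s r)), out ?c)"
      proof (rule step_INC_blank[where zs = "tl zs"])
        have "l = replicate (s r - 1) 1" and tl: "set (tl zs) \<subseteq> {0}"
          using reps[OF r] T by auto
        then have "1 # l = replicate (s r) 1"
          using False by (cases "s r") auto
        then show "tapes ?c ! r = (replicate (s r) 1, tl zs)"
          unfolding st using INC False r T sc[OF r] by (simp add: simps)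
        show "first_sym (tl zs) = 0" "set (tl (tl zs)) \<subseteq> {0}" using first_sym_zeros[OF tl] by auto
        show "counts (s j) (tapes ?c ! j)" if "j < k" "j \<noteq> r" for j
          unfolding st using INC that by (simp add: simps)
      qed (use INC False r assms(2) in \<open>simp_all add: st simps\<close>)
      moreover have "state ?c = pc" "pos ?c = i" "out ?c = w"
        unfolding st using INC False r by (simp_all add: simps)
      ultimately show ?thesis
        using INC by (intro exI[of _ 2]) (simp add: numeral_2_eq_2)
    qed
  next
    case (DEC r)
    then have r: "r < k" using assms(3) by simp
    obtain l zs where T: "tapes c ! r = (l, zs)" by force
    show ?thesis
    proof (cases "s r")
      case 0
      then show ?thesis using DEC r T reps[OF r] by (intro one) (auto simp: st simps)
    next
      case (Suc m)
      \<comment> \<open>Erasing the last one and moving left puts the head on the previous one; for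
        \<open>m = 0\<close> the left part is empty and \<open>first_sym []\<close> supplies the
        blank.\<close>
      have "counts m (tape_op (1, 0, Left) (l, zs))"
        using reps[OF r] T Suc by (cases m) auto
      then show ?thesis
        using DEC r T Suc sc[OF r] by (intro one) (simp add: st simps del: counts.simps tape_op.simps)
    qed
  next
    case (EMIT b)
    then show ?thesis by (intro one) (simp add: st simps)
  next
    case (JZ r p)
    then show ?thesis using assms(3) by (intro one) (simp add: st simps)
  next
    case (JMP p)
    then show ?thesis by (intro one) (simp add: st simps)
  next
    case (READ p)
    then show ?thesis by (intro one) (simp add: st simps)
  qed
qed

lemma rtranclp_instr_step_simulates:
  assumes "(instr_step P inp)\<^sup>*\<^sup>* a b" "represents k c a" "\<And>ins. ins \<in> set P \<Longrightarrow> instr_regs ins \<subseteq> {..<k}"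
  shows "\<exists>t. represents k ((step (machine_of P k) inp ^^ t) c) b"
  using assms(1)
proof (induction rule: rtranclp_induct)
  case base
  show ?case using assms(2) by (intro exI[of _ 0]) simp
next
  case (step b d)
  obtain t where t: "represents k ((step (machine_of P k) inp ^^ t) c) b" using step.IH by blast
  obtain pc i s w where b: "b = (pc, i, s, w)" by (cases b)
  have pc: "pc < length P" "d = exec_instr inp (P ! pc) (pc, i, s, w)"
    using step.hyps(2) b by (auto simp: instr_step_def)
  obtain u where "represents k ((step (machine_of P k) inp ^^ u) ((step (machine_of P k) inp ^^ t) c)) d"
    using step_simulates[OF t[unfolded b] pc(1) assms(3)[OF nth_mem[OF pc(1)]]] pc(2) by blast
  then show ?case by (intro exI[of _ "u + t"]) (simp add: funpow_add)
qed

lemma tranclp_instr_step_simulates: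
  assumes "(instr_step P inp)\<^sup>+\<^sup>+ a b" "represents k c a" "\<And>ins. ins \<in> set P \<Longrightarrow> instr_regs ins \<subseteq> {..<k}"
  shows "\<exists>t>0. represents k ((step (machine_of P k) inp ^^ t) c) b"
proof -
  obtain d where d: "instr_step P inp a d" "(instr_step P inp)\<^sup>*\<^sup>* d b"
    using assms(1) by (metis tranclpD)
  obtain pc i s w where a: "a = (pc, i, s, w)" by (cases a)
  have pc: "pc < length P" "d = exec_instr inp (P ! pc) (pc, i, s, w)"
    using d(1) a by (auto simp: instr_step_def)
  obtain t where t: "t > 0" "represents k ((step (machine_of P k) inp ^^ t) c) d"
    using step_simulates[OF assms(2)[unfolded a] pc(1) assms(3)[OF nth_mem[OF pc(1)]]] pc(2) by blast
  obtain u where "represents k ((step (machine_of P k) inp ^^ u) ((step (machine_of P k) inp ^^ t) c)) b"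
    using rtranclp_instr_step_simulates[OF d(2) t(2) assms(3)] by blast
  then show ?thesis using t(1) by (intro exI[of _ "u + t"]) (simp add: funpow_add)
qed

section \<open>Functions computed by loop programs\<close>

lemma For_0: "s r = 0 \<Longrightarrow> exec (For r c) (s, w) = (s, w)"
  by simp

text \<open>The second loop takes its number of rounds from the store left by the first round, so
  \<open>r\<close> must not occur in \<open>c\<close>. Later proofs remove
  \<open>exec.simps(7)\<close> from the simplifier, so that loops are rewritten by rules like this
  one instead of turning into iterates.\<close>

lemma For_Suc:
  assumes "r \<notin> regs c" "s r = Suc n"
  shows "exec (For r c) (s, w) = exec (For r c) (exec c (s(r := n), w))"
  using assms by (simp add: exec_other funpow_Suc_right del: funpow.simps)

lemma For_Skip: "exec (For a Skip) (s, w) = (s(a := 0), w)"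
proof (induction "s a" arbitrary: s)
  case 0
  then show ?case by (auto simp: For_0 fun_eq_iff)
next
  case (Suc n)
  then show ?case by (subst For_Suc[of _ _ _ n]) (simp_all del: exec.simps(7))
qed

lemma For_Inc:
  assumes "a \<noteq> b"
  shows "exec (For a (Inc b)) (s, w) = (s(a := 0, b := s b + s a), w)"
proof (induction "s a" arbitrary: s)
  case 0
  then show ?case by (auto simp: For_0 fun_eq_iff)
next
  case (Suc n)
  from Suc(2)[symmetric] assms show ?case
    by (subst For_Suc[of _ _ _ n]) (simp_all add: Suc(1) fun_upd_twist del: exec.simps(7))
qed

text \<open>A loop empties its counter. A register is therefore copied by moving it into two others
  and moving one of these back.\<close>

lemma For_Inc_Inc:
  assumes "a \<noteq> b" "a \<noteq> d" "b \<noteq> d"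
  shows "exec (For a (Inc b ;; Inc d)) (s, w) = (s(a := 0, b := s b + s a, d := s d + s a), w)"
proof (induction "s a" arbitrary: s)
  case 0
  then show ?case by (auto simp: For_0 fun_eq_iff)
next
  case (Suc n)
  from Suc(2)[symmetric] assms show ?case
    by (subst For_Suc[of _ _ _ n]) (auto simp add: Suc(1) fun_eq_iff simp del: exec.simps(7))
qed

lemma For_Emit: "exec (For a (Emit b)) (s, w) = (s(a := 0), w @ replicate (s a) b)"
proof (induction "s a" arbitrary: s w)
  case 0
  then show ?case by (auto simp: For_0 fun_eq_iff)
next
  case (Suc n)
  from Suc(2)[symmetric] show ?case
    by (subst For_Suc[of _ _ _ n]) (simp_all add: Suc(1) del: exec.simps(7))
qed

text \<open>Counting along the Cantor enumeration of pairs decodes a number without arithmetic.\<close>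

definition pair_succ :: "nat \<times> nat \<Rightarrow> nat \<times> nat" where
  "pair_succ p = (if snd p = 0 then (0, Suc (fst p)) else (Suc (fst p), snd p - 1))"

lemma prod_decode_Suc: "prod_decode (Suc n) = pair_succ (prod_decode n)"
proof -
  have "prod_encode (pair_succ p) = Suc (prod_encode p)" for p
    by (cases p; cases "snd p") (auto simp: pair_succ_def prod_encode_def)
  from this[of "prod_decode n"] show ?thesis
    by (metis prod_encode_inverse prod_decode_inverse)
qed

definition pair_succ_com :: "nat \<Rightarrow> nat \<Rightarrow> com" where
  "pair_succ_com a b = Cond b (Dec b ;; Inc a) (For a (Inc b) ;; Inc b)"

definition prod_decode_com :: "nat \<Rightarrow> nat \<Rightarrow> nat \<Rightarrow> com" where
  "prod_decode_com r a b = For r (pair_succ_com a b)"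

lemma pair_succ_com:
  assumes "a \<noteq> b"
  shows "exec (pair_succ_com a b) (s, w) =
    (s(a := fst (pair_succ (s a, s b)), b := snd (pair_succ (s a, s b))), w)"
  using assms by (auto simp: pair_succ_com_def pair_succ_def For_Inc fun_eq_iff simp del: exec.simps(7))

lemma regs_pair_succ_com: "regs (pair_succ_com a b) = {a, b}"
  by (auto simp: pair_succ_com_def)

lemma prod_decode_com:
  assumes "a \<noteq> b" "r \<noteq> a" "r \<noteq> b" "s a = 0" "s b = 0"
  shows "exec (prod_decode_com r a b) (s, w) =
    (s(r := 0, a := fst (prod_decode (s r)), b := snd (prod_decode (s r))), w)"
proof -
  \<comment> \<open>Generalization to an arbitrary start \<open>m\<close>: after the first round the
    registers no longer hold the decoding of 0.\<close>
  have "exec (For r (pair_succ_com a b)) (s, w) =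
      (s(r := 0, a := fst (prod_decode (m + s r)), b := snd (prod_decode (m + s r))), w)"
    if "(s a, s b) = prod_decode m" for m
    using that
  proof (induction "s r" arbitrary: s m)
    case 0
    then show ?case using assms(1-3) by (auto simp: For_0 fun_eq_iff prod_eq_iff)
  next
    case (Suc n)
    let ?s = "s(r := n, a := fst (prod_decode (Suc m)), b := snd (prod_decode (Suc m)))"
    have "exec (For r (pair_succ_com a b)) (s, w) = exec (For r (pair_succ_com a b)) (?s, w)"
      using Suc(2)[symmetric] assms(1-3) Suc(3)
      by (subst For_Suc[of _ _ _ n])
        (simp_all add: regs_pair_succ_com pair_succ_com prod_decode_Suc del: exec.simps(7))
    also have "\<dots> = (?s(r := 0, a := fst (prod_decode (Suc m + ?s r)),
        b := snd (prod_decode (Suc m + ?s r))), w)"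
      using assms(1-3) by (intro Suc(1)) auto
    also have "Suc m + ?s r = m + s r" using Suc(2)[symmetric] assms(1-3) by simp
    finally show ?case using assms(1-3) by (auto simp: fun_eq_iff)
  qed
  from this[of 0] show ?thesis using assms
    by (simp add: prod_decode_com_def prod_decode_def prod_decode_aux.simps)
qed

text \<open>Since \<open>triangle (Suc n) = triangle n + Suc n\<close>, each round increments
  \<open>i\<close> and adds it to \<open>z\<close>; \<open>a\<close> keeps the copy from which
  \<open>i\<close> is restored.\<close>

definition triangle_com :: "nat \<Rightarrow> nat \<Rightarrow> nat \<Rightarrow> nat \<Rightarrow> com" where
  "triangle_com a b z i = For b (Inc i ;; For i (Inc z ;; Inc a) ;; For a (Inc i))"

lemma triangle_com:
  assumes "distinct [a, b, z, i]" "s a = 0" "s z = v + triangle (s i)"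
  shows "exec (triangle_com a b z i) (s, w) =
    (s(b := 0, i := s i + s b, z := v + triangle (s i + s b)), w)"
  using assms(2,3)
proof (induction "s b" arbitrary: s)
  case 0
  then show ?case using assms(1) by (auto simp: For_0 fun_eq_iff triangle_com_def)
next
  case (Suc n)
  let ?s = "s(b := n, i := Suc (s i), z := v + triangle (Suc (s i)))"
  have "exec (triangle_com a b z i) (s, w) = exec (triangle_com a b z i) (?s, w)"
    unfolding triangle_com_def using Suc(2)[symmetric] assms(1) Suc(3,4)
    by (subst For_Suc[of _ _ _ n])
      (auto simp: For_Inc For_Inc_Inc fun_eq_iff simp del: exec.simps(7)
        intro!: arg_cong[of _ _ "exec _"])
  also have "\<dots> = (?s(b := 0, i := ?s i + ?s b, z := v + triangle (?s i + ?s b)), w)"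
    using assms(1) Suc(3,4) by (intro Suc(1)) auto
  finally show ?case using assms(1) Suc(2)[symmetric] by (auto simp: fun_eq_iff)
qed

text \<open>Rests on \<open>prod_encode (a, b) = triangle (a + b) + a\<close>: the first loop leaves
  the first component in \<open>z\<close> and the sum in \<open>b\<close>, and the triangle number
  of the sum is then added to \<open>z\<close>.\<close>

definition prod_encode_com :: "nat \<Rightarrow> nat \<Rightarrow> nat \<Rightarrow> nat \<Rightarrow> com" where
  "prod_encode_com a b z i =
     For a (Inc z ;; Inc b) ;; triangle_com a b z i ;; For i Skip ;; For z (Inc b)"

lemma prod_encode_com:
  assumes "distinct [a, b, z, i]" "s z = 0" "s i = 0"
  shows "exec (prod_encode_com a b z i) (s, w) = (s(a := 0, b := prod_encode (s a, s b)), w)"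
proof -
  let ?s = "s(a := 0, z := s a, b := s b + s a)"
  have "exec (prod_encode_com a b z i) (s, w) =
      exec (For i Skip ;; For z (Inc b)) (exec (triangle_com a b z i) (?s, w))"
    using assms by (simp add: prod_encode_com_def For_Inc_Inc del: exec.simps(7))
  also have "exec (triangle_com a b z i) (?s, w) =
      (?s(b := 0, i := ?s i + ?s b, z := s a + triangle (?s i + ?s b)), w)"
    using assms by (intro triangle_com) auto
  finally show ?thesis using assms
    by (auto simp: For_Skip For_Inc fun_eq_iff prod_encode_def add.commute simp del: exec.simps(7))
qed

text \<open>
  Scratch registers are zero before and after, and registers above \<open>N\<close> are untouched, so that
  programs can be combined without renaming registers.
\<close>

definition implements :: "com \<Rightarrow> nat \<Rightarrow> (nat \<Rightarrow> nat) \<Rightarrow> bool" where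
  "implements c N f \<longleftrightarrow> wf_com c \<and> regs c \<subseteq> {..N} \<and>
     (\<forall>s w. (\<forall>j. 0 < j \<longrightarrow> j \<le> N \<longrightarrow> s j = 0) \<longrightarrow> exec c (s, w) = (s(0 := f (s 0)), w))"

definition loop_computable :: "(nat \<Rightarrow> nat) \<Rightarrow> bool" where
  "loop_computable f \<longleftrightarrow> (\<exists>c N. implements c N f)"

lemma loop_computableI:
  assumes "wf_com c" "regs c \<subseteq> {..N}"
    "\<And>s w. (\<And>j. 0 < j \<Longrightarrow> j \<le> N \<Longrightarrow> s j = 0) \<Longrightarrow> exec c (s, w) = (s(0 := f (s 0)), w)"
  shows "loop_computable f"
  unfolding loop_computable_def implements_def using assms
  by (intro exI[of _ c] exI[of _ N]) auto

lemma implementsD: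
  assumes "implements c N f"
  shows "wf_com c" "M \<ge> N \<Longrightarrow> regs c \<subseteq> {..M}"
    "(\<And>j. 0 < j \<Longrightarrow> j \<le> N \<Longrightarrow> s j = 0) \<Longrightarrow> exec c (s, w) = (s(0 := f (s 0)), w)"
  using assms unfolding implements_def by force+

section \<open>Basic functions; closure under composition, pairing and iteration\<close>

lemma loop_computable_Suc: "loop_computable Suc"
  by (rule loop_computableI[of "Inc 0" 0]) auto

lemma loop_computable_zero: "loop_computable (\<lambda>x. 0)"
  by (rule loop_computableI[of "For 0 Skip" 0]) (auto simp: For_Skip simp del: exec.simps(7))

lemma loop_computable_id: "loop_computable (\<lambda>x. x)"
  by (rule loop_computableI[of "Skip" 0]) auto

lemma loop_computable_comp:
  assumes "loop_computable f" "loop_computable g"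
  shows "loop_computable (\<lambda>x. f (g x))"
proof -
  obtain c N where "implements c N f"
    using assms unfolding loop_computable_def by blast
  note c = implementsD[OF this]
  obtain d L where "implements d L g"
    using assms unfolding loop_computable_def by blast
  note d = implementsD[OF this]
  show ?thesis
  proof (rule loop_computableI[of "d ;; c" "max N L"])
    show "regs (d ;; c) \<subseteq> {..max N L}" using c(2)[of "max N L"] d(2)[of "max N L"] by simp
  qed (use c d in simp_all)
qed

lemma loop_computable_fst: "loop_computable (\<lambda>x. fst (prod_decode x))"
  by (rule loop_computableI[of "prod_decode_com 0 1 2 ;; For 1 (Inc 0) ;; For 2 Skip" 2])
    (auto simp: prod_decode_com For_Inc For_Skip fun_eq_iff simp del: exec.simps(7),
     auto simp: prod_decode_com_def pair_succ_com_def)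

lemma loop_computable_snd: "loop_computable (\<lambda>x. snd (prod_decode x))"
  by (rule loop_computableI[of "prod_decode_com 0 1 2 ;; For 2 (Inc 0) ;; For 1 Skip" 2])
    (auto simp: prod_decode_com For_Inc For_Skip fun_eq_iff simp del: exec.simps(7),
     auto simp: prod_decode_com_def pair_succ_com_def)

lemma loop_computable_pair:
  assumes "loop_computable f" "loop_computable g"
  shows "loop_computable (\<lambda>x. prod_encode (f x, g x))"
proof -
  obtain c N where "implements c N f"
    using assms unfolding loop_computable_def by blast
  note c = implementsD[OF this]
  obtain d L where "implements d L g"
    using assms unfolding loop_computable_def by blast
  note d = implementsD[OF this]
  \<comment> \<open>Registers from \<open>m\<close> on lie beyond the scratch space of both
    programs: \<open>m\<close> keeps the argument while \<open>c\<close> runs, and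
    \<open>m + 1\<close> keeps the value of \<open>f\<close> while \<open>d\<close> runs.\<close>
  define m where "m = Suc (max N L)"
  have m: "N < m" "L < m" "0 < m" by (auto simp: m_def)
  let ?p = "For 0 (Inc m ;; Inc (m + 1)) ;; For (m + 1) (Inc 0) ;; c ;; For 0 (Inc (m + 1)) ;;
    For m (Inc 0) ;; d ;; prod_encode_com (m + 1) 0 m (m + 2)"
  show ?thesis
  proof (rule loop_computableI[of ?p "m + 2"])
    show "wf_com ?p" using c d m
      by (auto simp: prod_encode_com_def triangle_com_def)
    show "regs ?p \<subseteq> {..m + 2}" using c(2)[of "m + 2"] d(2)[of "m + 2"] m
      by (auto simp: prod_encode_com_def triangle_com_def)
  next
    fix s :: "nat \<Rightarrow> nat" and w
    assume s: "\<And>j. 0 < j \<Longrightarrow> j \<le> m + 2 \<Longrightarrow> s j = 0"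
    have 1: "exec (For 0 (Inc m ;; Inc (m + 1)) ;; For (m + 1) (Inc 0)) (s, w) =
        (s(m := s 0), w)"
      using m s[of "m + 1"] s[of m]
      by (auto simp: For_Inc For_Inc_Inc fun_eq_iff simp del: exec.simps(7))
    have 2: "exec c (s(m := s 0), w) = (s(m := s 0, 0 := f (s 0)), w)"
      using c(3)[of "s(m := s 0)"] m s by auto
    have 3: "exec (For 0 (Inc (m + 1)) ;; For m (Inc 0)) (s(m := s 0, 0 := f (s 0)), w) =
        (s(m + 1 := f (s 0)), w)"
      using m s[of "m + 1"] s[of m]
      by (auto simp: For_Inc For_Inc_Inc fun_eq_iff simp del: exec.simps(7))
    have 4: "exec d (s(m + 1 := f (s 0)), w) = (s(m + 1 := f (s 0), 0 := g (s 0)), w)"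
      using d(3)[of "s(m + 1 := f (s 0))"] m s by auto
    have 5: "exec (prod_encode_com (m + 1) 0 m (m + 2)) (s(m + 1 := f (s 0), 0 := g (s 0)), w) =
        (s(0 := prod_encode (f (s 0), g (s 0))), w)"
      using m s[of "m + 1"] s[of m] s[of "m + 2"] by (subst prod_encode_com) (auto simp: fun_eq_iff)
    show "exec ?p (s, w) = (s(0 := prod_encode (f (s 0), g (s 0))), w)"
      using 1 2 3 4 5 by (simp del: exec.simps(7))
  qed
qed

text \<open>From here on the only source of recursion: tests, arithmetic, folds over lists and runs
  of machines all reduce to it.\<close>

lemma loop_computable_iterate:
  assumes "loop_computable f"
  shows "loop_computable (\<lambda>x. (f ^^ snd (prod_decode x)) (fst (prod_decode x)))"
proof -
  obtain c N where "implements c N f"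
    using assms unfolding loop_computable_def by blast
  note c = implementsD[OF this]
  define m where "m = Suc N"
  have m: "N < m" "0 < m" by (auto simp: m_def)
  have nin: "m + 1 \<notin> regs c" using c(2)[of N] m by auto
  let ?p = "prod_decode_com 0 m (m + 1) ;; For m (Inc 0) ;; For (m + 1) c"
  have loop: "exec (For (m + 1) c) (s, w) = (s(m + 1 := 0, 0 := (f ^^ s (m + 1)) (s 0)), w)"
    if "\<And>j. 0 < j \<Longrightarrow> j \<le> N \<Longrightarrow> s j = 0" for s w
    using that
  proof (induction "s (m + 1)" arbitrary: s)
    case 0
    then show ?case by (auto simp: For_0 fun_eq_iff)
  next
    case (Suc n)
    let ?s = "s(m + 1 := n, 0 := f (s 0))"
    have "exec (For (m + 1) c) (s, w) = exec (For (m + 1) c) (?s, w)"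
      using Suc(2)[symmetric] c(3)[of "s(m + 1 := n)"] Suc(3) nin m
      by (subst For_Suc[of _ _ _ n]) (simp_all del: exec.simps(7))
    also have "\<dots> = (?s(m + 1 := 0, 0 := (f ^^ ?s (m + 1)) (?s 0)), w)"
      using Suc(3) m by (intro Suc(1)) auto
    finally show ?case using Suc(2)[symmetric] m
      by (auto simp: fun_eq_iff funpow_Suc_right simp del: funpow.simps)
  qed
  show ?thesis
  proof (rule loop_computableI[of ?p "m + 1"])
    show "wf_com ?p" using c m nin
      by (auto simp: prod_decode_com_def pair_succ_com_def)
    show "regs ?p \<subseteq> {..m + 1}" using c(2)[of "m + 1"] m
      by (auto simp: prod_decode_com_def pair_succ_com_def)
  next
    fix s :: "nat \<Rightarrow> nat" and w
    assume s: "\<And>j. 0 < j \<Longrightarrow> j \<le> m + 1 \<Longrightarrow> s j = 0"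
    let ?x = "prod_decode (s 0)"
    have 1: "exec (prod_decode_com 0 m (m + 1)) (s, w) =
        (s(0 := 0, m := fst ?x, m + 1 := snd ?x), w)"
      using m s by (intro prod_decode_com) auto
    have 2: "exec (For m (Inc 0)) (s(0 := 0, m := fst ?x, m + 1 := snd ?x), w) =
        (s(0 := fst ?x, m + 1 := snd ?x), w)"
      using m s[of m] by (auto simp: For_Inc fun_eq_iff simp del: exec.simps(7))
    have "exec ?p (s, w) = exec (For (m + 1) c) (s(0 := fst ?x, m + 1 := snd ?x), w)"
      using 1 2 by (simp del: exec.simps(7))
    also have "\<dots> = (s(0 := (f ^^ snd ?x) (fst ?x)), w)"
      using m s by (subst loop) (auto simp: fun_eq_iff)
    finally show "exec ?p (s, w) = (s(0 := (f ^^ snd ?x) (fst ?x)), w)" .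
  qed
qed

section \<open>Enumeration by a Turing machine\<close>

lemma step_out: "\<exists>v. out (step M inp c) = out c @ v"
  by (auto simp: step_def apply_rule_def split: option.splits)

lemma run_add: "run M inp (t + d) = (step M inp ^^ d) (run M inp t)"
  by (subst add.commute) (simp add: run_def funpow_add)

lemma out_run_mono:
  assumes "t \<le> t'"
  shows "\<exists>v. out (run M inp t') = out (run M inp t) @ v"
proof -
  have "\<exists>v. out (run M inp (t + d)) = out (run M inp t) @ v" for d
  proof (induction d)
    case (Suc d)
    then show ?case
      using step_out[of M inp "run M inp (t + d)"] by (auto simp: run_def)
  qed simp
  from this[of "t' - t"] show ?thesis using assms by simp
qed

lemma set_blocks_append: "set (blocks n u) \<subseteq> set (blocks n (u @ v))"
  by (induction n u rule: blocks.induct) auto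

lemma blocks_word: "blocks n (replicate m True @ False # w) = (n + m) # blocks 0 w"
  by (induction m arbitrary: n) auto

definition unary_word :: "(nat \<Rightarrow> nat) \<Rightarrow> nat \<Rightarrow> bool list" where
  "unary_word h s = concat (map (\<lambda>i. replicate (h i) True @ [False]) [0..<s])"

lemma blocks_word_list: "blocks 0 (concat (map (\<lambda>i. replicate (h i) True @ [False]) xs)) = map h xs"
  by (induction xs) (simp_all add: blocks_word)

lemma set_blocks_word: "set (blocks 0 (unary_word h s)) = h ` {..<s}"
  by (simp add: unary_word_def blocks_word_list atLeast0LessThan)

text \<open>The output need be known only at arbitrarily late times: at any other time it is a
  prefix of a later known word and lists no number beyond those of that word.\<close>

lemma enumerates_eqI:
  assumes "\<And>s. \<exists>t\<ge>s. out (run M inp t) = unary_word h s"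
  shows "enumerates M inp = range h"
proof (intro equalityI subsetI)
  fix c assume "c \<in> enumerates M inp"
  then obtain t where t: "c \<in> set (blocks 0 (out (run M inp t)))"
    by (auto simp: enumerates_def)
  obtain t' where "t \<le> t'" and t': "out (run M inp t') = unary_word h t"
    using assms by blast
  then obtain v where "unary_word h t = out (run M inp t) @ v"
    using out_run_mono by metis
  then have "c \<in> set (blocks 0 (unary_word h t))"
    using t set_blocks_append by fastforce
  then show "c \<in> range h" by (auto simp: set_blocks_word)
next
  fix c assume "c \<in> range h"
  then obtain s where "c = h s" by blast
  then have "c \<in> set (blocks 0 (unary_word h (Suc s)))" by (simp add: set_blocks_word)
  then show "c \<in> enumerates M inp"
    using assms[of "Suc s"] by (auto simp: enumerates_def) metis
qed

text \<open>Register \<open>m\<close> holds the input and \<open>m + 1\<close> the stage; with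
  \<open>m\<close> above the registers of \<open>c\<close>, both survive it. They are copied with
  the help of \<open>m + 3\<close> and paired in register 0. Printing the value of \<open>c\<close>
  empties register 0 for the next pass.\<close>

definition enum_com :: "com \<Rightarrow> nat \<Rightarrow> com" where
  "enum_com c m =
     For m (Inc (m + 2) ;; Inc (m + 3)) ;; For (m + 3) (Inc m) ;;
     For (m + 1) (Inc 0 ;; Inc (m + 3)) ;; For (m + 3) (Inc (m + 1)) ;;
     prod_encode_com (m + 2) 0 (m + 3) (m + 4) ;; c ;;
     For 0 (Emit True) ;; Emit False ;; Inc (m + 1)"

lemma enum_com:
  assumes "implements c N f" "N < m"
  shows "exec (enum_com c m) ((\<lambda>_. 0)(m := e, m + 1 := s), w) =
    ((\<lambda>_. 0)(m := e, m + 1 := Suc s), w @ replicate (f (prod_encode (e, s))) True @ [False])"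
proof -
  let ?s = "(\<lambda>_. 0)(m := e, m + 1 := s) :: nat \<Rightarrow> nat"
  have 1: "exec (For m (Inc (m + 2) ;; Inc (m + 3)) ;; For (m + 3) (Inc m)) (?s, w) =
      (?s(m + 2 := e), w)"
    using assms(2) by (auto simp: For_Inc For_Inc_Inc fun_eq_iff simp del: exec.simps(7))
  have 2: "exec (For (m + 1) (Inc 0 ;; Inc (m + 3)) ;; For (m + 3) (Inc (m + 1)))
      (?s(m + 2 := e), w) = (?s(m + 2 := e, 0 := s), w)"
    using assms(2) by (auto simp: For_Inc For_Inc_Inc fun_eq_iff simp del: exec.simps(7))
  have 3: "exec (prod_encode_com (m + 2) 0 (m + 3) (m + 4)) (?s(m + 2 := e, 0 := s), w) =
      (?s(0 := prod_encode (e, s)), w)"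
    using assms(2) by (subst prod_encode_com) (auto simp: fun_eq_iff)
  have 4: "exec c (?s(0 := prod_encode (e, s)), w) = (?s(0 := f (prod_encode (e, s))), w)"
    using assms(2) by (subst implementsD(3)[OF assms(1)]) auto
  have 5: "exec (For 0 (Emit True) ;; Emit False ;; Inc (m + 1)) (?s(0 := f (prod_encode (e, s))), w) =
    ((\<lambda>_. 0)(m := e, m + 1 := Suc s), w @ replicate (f (prod_encode (e, s))) True @ [False])"
    using assms(2) by (auto simp: For_Emit fun_eq_iff simp del: exec.simps(7))
  show ?thesis
    using 1 2 3 4 5 unfolding enum_com_def by (simp del: exec.simps(7))
qed

text \<open>The first three instructions count the unary input into \<open>m\<close>; the first
  blank leads to address 3, where the body starts and to which the final jump returns
  forever.\<close>

definition enum_prog :: "com \<Rightarrow> nat \<Rightarrow> instr list" where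
  "enum_prog c m = [READ 3, INC m, JMP 0] @ compile (enum_com c m) 3 @ [JMP 3]"

lemma enum_prog_read:
  assumes "i \<le> e"
  shows "(instr_step (enum_prog c m) (nat_input e))\<^sup>*\<^sup>* (0, 0, (\<lambda>_. 0), []) (0, i, (\<lambda>_. 0)(m := i), [])"
  using assms
proof (induction i)
  case 0
  have "(\<lambda>_. 0)(m := 0) = (\<lambda>_. 0 :: nat)" by auto
  then show ?case by simp
next
  case (Suc i)
  let ?R = "instr_step (enum_prog c m) (nat_input e)"
  have "?R (0, i, (\<lambda>_. 0)(m := i), []) (1, Suc i, (\<lambda>_. 0)(m := i), [])"
    by (rule instr_stepI[where ins = "READ 3"]) (use Suc.prems in \<open>auto simp: enum_prog_def nat_input_def\<close>)
  moreover have "?R (1, Suc i, (\<lambda>_. 0)(m := i), []) (2, Suc i, (\<lambda>_. 0)(m := Suc i), [])"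
    by (rule instr_stepI[where ins = "INC m"]) (auto simp: enum_prog_def)
  moreover have "?R (2, Suc i, (\<lambda>_. 0)(m := Suc i), []) (0, Suc i, (\<lambda>_. 0)(m := Suc i), [])"
    by (rule instr_stepI[where ins = "JMP 0"]) (auto simp: enum_prog_def)
  ultimately show ?case using Suc by (meson Suc_leD rtranclp.rtrancl_into_rtrancl)
qed

lemma enum_prog_start:
  "(instr_step (enum_prog c m) (nat_input e))\<^sup>*\<^sup>* (0, 0, (\<lambda>_. 0), [])
     (3, e, (\<lambda>_. 0)(m := e, m + 1 := 0), [])"
proof -
  have eq: "(\<lambda>_. 0)(m := e, m + 1 := 0) = ((\<lambda>_. 0)(m := e) :: nat \<Rightarrow> nat)" by auto
  have "instr_step (enum_prog c m) (nat_input e) (0, e, (\<lambda>_. 0)(m := e), []) (3, e, (\<lambda>_. 0)(m := e), [])"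
    by (rule instr_stepI[where ins = "READ 3"]) (auto simp: enum_prog_def nat_input_def)
  with enum_prog_read[OF order_refl] show ?thesis
    unfolding eq by (rule rtranclp.rtrancl_into_rtrancl)
qed

lemma enum_prog_loop:
  assumes "implements c N f" "N < m"
  shows "(instr_step (enum_prog c m) inp)\<^sup>+\<^sup>+ (3, i, (\<lambda>_. 0)(m := e, m + 1 := s), w)
    (3, i, (\<lambda>_. 0)(m := e, m + 1 := Suc s), w @ replicate (f (prod_encode (e, s))) True @ [False])"
    (is "?R\<^sup>+\<^sup>+ (3, i, ?\<sigma>) (3, i, ?\<tau>)")
proof -
  let ?A = "[READ 3, INC m, JMP 0]"
  let ?C = "compile (enum_com c m) 3"
  have "wf_com (enum_com c m)"
    using implementsD(1)[OF assms(1)] assms(2)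
    by (auto simp: enum_com_def prod_encode_com_def triangle_com_def)
  from compile_correct[OF this, of ?A "[JMP 3]" inp i ?\<sigma>]
  have "?R\<^sup>*\<^sup>* (3, i, ?\<sigma>) (3 + length ?C, i, ?\<tau>)"
    unfolding enum_com[OF assms] by (simp add: enum_prog_def eval_nat_numeral)
  moreover have "?R (3 + length ?C, i, ?\<tau>) (3, i, ?\<tau>)"
    by (rule instr_stepI[where ins = "JMP 3"]) (auto simp: enum_prog_def nth_append)
  ultimately show ?thesis by (rule rtranclp_into_tranclp1)
qed

theorem loop_computable_enumerable:
  assumes "loop_computable f"
  shows "\<exists>M. \<forall>e. enumerates M (nat_input e) = range (\<lambda>s. f (prod_encode (e, s)))"
proof -
  obtain c N where c: "implements c N f" using assms unfolding loop_computable_def by blast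
  define m where "m = Suc N"
  \<comment> \<open>The highest register in use is \<open>m + 4\<close>.\<close>
  define M where "M = machine_of (enum_prog c m) (m + 5)"
  have m: "N < m" by (simp add: m_def)
  have "regs (enum_com c m) \<subseteq> {..<m + 5}"
    using implementsD(2)[OF c order_refl] m
    by (auto simp: enum_com_def prod_encode_com_def triangle_com_def)
  then have regs: "instr_regs ins \<subseteq> {..<m + 5}" if "ins \<in> set (enum_prog c m)" for ins
    using that instr_regs_compile[of ins "enum_com c m" 3] by (auto simp: enum_prog_def)
  have "enumerates M (nat_input e) = range (\<lambda>s. f (prod_encode (e, s)))" for e
  proof (rule enumerates_eqI)
    fix s
    let ?h = "\<lambda>s. f (prod_encode (e, s))"
    \<comment> \<open>Every pass takes at least one step, which gives the bound on
      \<open>t\<close>.\<close>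
    have "\<exists>t\<ge>s. represents (m + 5) (run M (nat_input e) t)
        (3, e, (\<lambda>_. 0)(m := e, m + 1 := s), unary_word ?h s)"
    proof (induction s)
      case 0
      have "represents (m + 5) (init M) (0, 0, (\<lambda>_. 0), [])"
        by (simp add: represents_def init_def M_def machine_of_def)
      from rtranclp_instr_step_simulates[OF enum_prog_start[of c m e] this regs]
      obtain t where "represents (m + 5) ((step M (nat_input e) ^^ t) (init M))
          (3, e, (\<lambda>_. 0)(m := e, m + 1 := 0), [])"
        unfolding M_def by blast
      moreover have "unary_word ?h 0 = []" by (simp add: unary_word_def)
      ultimately show ?case by (intro exI[of _ t]) (simp only: run_def le0 simp_thms)
    next
      case (Suc s)
      then obtain t where t: "t \<ge> s" "represents (m + 5) (run M (nat_input e) t)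
        (3, e, (\<lambda>_. 0)(m := e, m + 1 := s), unary_word ?h s)" by blast
      from tranclp_instr_step_simulates[OF enum_prog_loop[OF c m] this(2) regs]
      obtain d where "d > 0" "represents (m + 5) ((step M (nat_input e) ^^ d) (run M (nat_input e) t))
        (3, e, (\<lambda>_. 0)(m := e, m + 1 := Suc s), unary_word ?h s @ replicate (?h s) True @ [False])"
        unfolding M_def by blast
      moreover have "unary_word ?h (Suc s) = unary_word ?h s @ replicate (?h s) True @ [False]"
        by (simp add: unary_word_def)
      moreover have "Suc s \<le> t + d" using \<open>d > 0\<close> t(1) by simp
      ultimately show ?case
        by (intro exI[of _ "t + d"]) (simp only: run_add simp_thms)
    qed
    then show "\<exists>t\<ge>s. out (run M (nat_input e) t) = unary_word ?h s"
      by (auto simp: represents_def)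
  qed
  then show ?thesis by blast
qed

section \<open>Computability on encoded types\<close>

lemma loop_computable_const: "loop_computable (\<lambda>x. n)"
  by (induction n) (auto intro: loop_computable_zero loop_computable_comp[OF loop_computable_Suc])

text \<open>Codes carry computability over to pairs, lists, options and records; injectivity is what
  makes equality testable on codes.\<close>

class enc =
  fixes enc :: "'a \<Rightarrow> nat"
  assumes enc_eqD: "enc x = enc y \<Longrightarrow> x = y"

lemma enc_eq_iff: "enc x = enc y \<longleftrightarrow> x = y"
  using enc_eqD by blast

instantiation nat :: enc
begin
definition enc_nat :: "nat \<Rightarrow> nat" where "enc_nat n = n"
instance by standard (simp add: enc_nat_def)
end

instantiation bool :: enc
begin
definition enc_bool :: "bool \<Rightarrow> nat" where "enc_bool b = (if b then 1 else 0)"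
instance by standard (simp add: enc_bool_def split: if_splits)
end

instantiation prod :: (enc, enc) enc
begin
definition enc_prod :: "'a \<times> 'b \<Rightarrow> nat" where
  "enc_prod p = prod_encode (enc (fst p), enc (snd p))"
instance by standard (simp add: enc_prod_def prod_eq_iff enc_eq_iff)
end

instantiation option :: (enc) enc
begin
definition enc_option :: "'a option \<Rightarrow> nat" where
  "enc_option x = (case x of None \<Rightarrow> 0 | Some y \<Rightarrow> Suc (enc y))"
instance by standard (auto simp: enc_option_def enc_eq_iff split: option.splits)
end

instantiation list :: (enc) enc
begin
definition enc_list :: "'a list \<Rightarrow> nat" where
  "enc_list xs = list_encode (map enc xs)"
instance
proof
  show "xs = ys" if "enc xs = enc ys" for xs ys :: "'a list"
    using that inj_map_eq_map[of "enc :: 'a \<Rightarrow> nat" xs ys]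
    by (simp add: enc_list_def list_encode_eq inj_def enc_eq_iff)
qed
end

instantiation move :: enc
begin
definition enc_move :: "move \<Rightarrow> nat" where
  "enc_move d = (case d of Stay \<Rightarrow> 0 | Left \<Rightarrow> 1 | Right \<Rightarrow> 2)"
instance by standard (auto simp: enc_move_def split: move.splits)
end

text \<open>\<open>g\<close> is free outside the range of \<open>enc\<close>, so encodings need not
  be surjective.\<close>

definition computable :: "('a::enc \<Rightarrow> 'b::enc) \<Rightarrow> bool" where
  "computable f \<longleftrightarrow> (\<exists>g. loop_computable g \<and> (\<forall>x. g (enc x) = enc (f x)))"

named_theorems computable_intros

lemma computableI: "loop_computable g \<Longrightarrow> (\<And>x. g (enc x) = enc (f x)) \<Longrightarrow> computable f"
  by (auto simp: computable_def)

lemma computable_nat_iff: "computable (f :: nat \<Rightarrow> nat) \<longleftrightarrow> loop_computable f"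
proof -
  have "g = f" if "\<forall>x. g x = f x" for g using that by auto
  then show ?thesis by (auto simp: computable_def enc_nat_def)
qed

lemma computable_id [computable_intros]: "computable (\<lambda>x. x)"
  by (rule computableI[OF loop_computable_id]) simp

lemma computable_const [computable_intros]: "computable (\<lambda>x. c)"
  by (rule computableI[OF loop_computable_const]) simp

lemma computable_comp:
  assumes "computable f" "computable g"
  shows "computable (\<lambda>x. f (g x))"
proof -
  obtain f' where f: "loop_computable f'" "\<And>x. f' (enc x) = enc (f x)" using assms(1) unfolding computable_def by blast
  obtain g' where g: "loop_computable g'" "\<And>x. g' (enc x) = enc (g x)" using assms(2) unfolding computable_def by blast
  show ?thesis by (rule computableI[OF loop_computable_comp[OF f(1) g(1)]]) (simp add: f g)
qed

lemma computable_Pair [computable_intros]: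
  assumes "computable f" "computable g"
  shows "computable (\<lambda>x. (f x, g x))"
proof -
  obtain f' where f: "loop_computable f'" "\<And>x. f' (enc x) = enc (f x)" using assms(1) unfolding computable_def by blast
  obtain g' where g: "loop_computable g'" "\<And>x. g' (enc x) = enc (g x)" using assms(2) unfolding computable_def by blast
  show ?thesis by (rule computableI[OF loop_computable_pair[OF f(1) g(1)]]) (simp add: f g enc_prod_def)
qed

lemma computable_fst [computable_intros]: "computable f \<Longrightarrow> computable (\<lambda>x. fst (f x))"
  by (rule computable_comp[of fst], rule computableI[OF loop_computable_fst]) (simp_all add: enc_prod_def)

lemma computable_snd [computable_intros]: "computable f \<Longrightarrow> computable (\<lambda>x. snd (f x))"
  by (rule computable_comp[of snd], rule computableI[OF loop_computable_snd]) (simp_all add: enc_prod_def)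

lemma computable_enc [computable_intros]: "computable f \<Longrightarrow> computable (\<lambda>x. enc (f x))"
  by (rule computable_comp[of enc], rule computableI[OF loop_computable_id]) (simp_all add: enc_nat_def)

lemma computable_Suc [computable_intros]: "computable f \<Longrightarrow> computable (\<lambda>x. Suc (f x))"
  by (rule computable_comp[of Suc], rule computableI[OF loop_computable_Suc]) (simp_all add: enc_nat_def)

lemma computable_funpow [computable_intros]:
  fixes g :: "'a::enc \<Rightarrow> 'b::enc \<Rightarrow> 'b"
  assumes "computable (\<lambda>p. g (fst p) (snd p))" "computable n" "computable a"
  shows "computable (\<lambda>x. (g x ^^ n x) (a x))"
proof -
  \<comment> \<open>Only a fixed function of one number can be iterated, so the parameter
    \<open>x\<close> travels along as first component.\<close>
  have "computable (\<lambda>p. (fst p, g (fst p) (snd p)))"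
    by (intro computable_intros assms)
  then obtain h where h: "loop_computable h" "\<And>p. h (enc p) = enc (fst p, g (fst p) (snd p))"
    unfolding computable_def by blast
  have it: "(h ^^ k) (enc (x, s)) = enc (x, (g x ^^ k) s)" for k x s
    by (induction k) (simp_all add: h)
  have "computable (\<lambda>x. ((x, a x), n x))" by (intro computable_intros assms)
  then obtain j where j: "loop_computable j" "\<And>x. j (enc x) = enc ((x, a x), n x)"
    unfolding computable_def by blast
  show ?thesis
    by (rule computableI[OF loop_computable_comp[OF loop_computable_snd loop_computable_comp[OF loop_computable_iterate[OF h(1)] j(1)]]])
      (use it in \<open>simp add: j(2) enc_prod_def enc_nat_def\<close>)
qed

section \<open>Tests and arithmetic\<close>

lemma computable_if [computable_intros]:
  assumes "computable b" "computable f" "computable g"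
  shows "computable (\<lambda>x. if b x then f x else g x)"
proof -
  \<comment> \<open>\<open>enc (b x)\<close> is 1 or 0: the constant function is applied once or not
    at all.\<close>
  have "computable (\<lambda>x. ((\<lambda>_. f x) ^^ enc (b x)) (g x))"
    by (intro computable_intros assms computable_comp[OF assms(2)])
  also have "(\<lambda>x. ((\<lambda>_. f x) ^^ enc (b x)) (g x)) = (\<lambda>x. if b x then f x else g x)"
    by (auto simp: enc_bool_def)
  finally show ?thesis .
qed

lemma computable_zero_test [computable_intros]:
  assumes "computable f"
  shows "computable (\<lambda>x. f x = (0 :: nat))"
proof -
  have "computable (\<lambda>x. ((\<lambda>_. False) ^^ f x) True)"
    by (intro computable_intros assms)
  moreover have "((\<lambda>_. False) ^^ n) True \<longleftrightarrow> n = 0" for n :: nat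
    by (cases n) auto
  ultimately show ?thesis by simp
qed

lemma computable_pred [computable_intros]:
  assumes "computable f"
  shows "computable (\<lambda>x. f x - (1 :: nat))"
proof -
  have "computable (\<lambda>x. fst (((\<lambda>p :: nat \<times> nat. (snd p, Suc (snd p))) ^^ f x) (0, 0)))"
    by (intro computable_intros assms)
  moreover have "((\<lambda>p :: nat \<times> nat. (snd p, Suc (snd p))) ^^ n) (0, 0) = (n - 1, n)" for n
    by (induction n) auto
  ultimately show ?thesis by simp
qed

lemma computable_add [computable_intros]:
  assumes "computable f" "computable g"
  shows "computable (\<lambda>x. f x + g x :: nat)"
proof -
  have "computable (\<lambda>x. (Suc ^^ g x) (f x))"
    by (intro computable_intros assms)
  moreover have "(Suc ^^ n) m = m + n" for m n
    by (induction n) auto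
  ultimately show ?thesis by (simp add: add.commute)
qed

lemma computable_diff [computable_intros]:
  assumes "computable f" "computable g"
  shows "computable (\<lambda>x. f x - g x :: nat)"
proof -
  have "computable (\<lambda>x. ((\<lambda>m. m - 1) ^^ g x) (f x))"
    by (intro computable_intros assms)
  moreover have "((\<lambda>m. m - 1) ^^ n) m = m - n" for m n :: nat
    by (induction n) auto
  ultimately show ?thesis by simp
qed

lemma computable_less [computable_intros]:
  assumes "computable f" "computable g"
  shows "computable (\<lambda>x. f x < (g x :: nat))"
proof -
  have "computable (\<lambda>x. Suc (f x) - g x = 0)"
    by (intro computable_intros assms)
  then show ?thesis by (simp add: Suc_le_eq)
qed

lemma computable_eq [computable_intros]:
  assumes "computable f" "computable g"
  shows "computable (\<lambda>x. f x = g x)"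
proof -
  have "computable (\<lambda>x. (enc (f x) - enc (g x)) + (enc (g x) - enc (f x)) = 0)"
    by (intro computable_intros assms)
  moreover have "(m - n) + (n - m) = 0 \<longleftrightarrow> m = n" for m n :: nat
    by auto
  ultimately show ?thesis by (simp only: enc_eq_iff)
qed

lemma computable_conj [computable_intros]:
  assumes "computable f" "computable g"
  shows "computable (\<lambda>x. f x \<and> g x)"
proof -
  have "computable (\<lambda>x. if f x then g x else False)"
    by (intro computable_intros assms)
  moreover have "(\<lambda>x. if f x then g x else False) = (\<lambda>x. f x \<and> g x)" by auto
  ultimately show ?thesis by (simp only:)
qed

lemma computable_not [computable_intros]:
  assumes "computable f"
  shows "computable (\<lambda>x. \<not> f x)"
proof -
  have "computable (\<lambda>x. if f x then False else True)"
    by (intro computable_intros assms)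
  moreover have "(\<lambda>x. if f x then False else True) = (\<lambda>x. \<not> f x)" by auto
  ultimately show ?thesis by (simp only:)
qed

lemma computable_disj [computable_intros]:
  assumes "computable f" "computable g"
  shows "computable (\<lambda>x. f x \<or> g x)"
proof -
  have "computable (\<lambda>x. if f x then True else g x)"
    by (intro computable_intros assms)
  moreover have "(\<lambda>x. if f x then True else g x) = (\<lambda>x. f x \<or> g x)" by auto
  ultimately show ?thesis by (simp only:)
qed

text \<open>Codes of options and of lists are 0 in the empty case and successors otherwise, so case
  distinctions on them become a zero test and a predecessor on numbers.\<close>

lemma loop_computable_if_zero:
  assumes "loop_computable n" "loop_computable a" "loop_computable b"
  shows "loop_computable (\<lambda>x. if n x = 0 then a x else b x)"
  using assms unfolding computable_nat_iff[symmetric] by (intro computable_intros)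

lemma loop_computable_pred: "loop_computable n \<Longrightarrow> loop_computable (\<lambda>x. n x - 1)"
  unfolding computable_nat_iff[symmetric] by (intro computable_intros)

lemma computable_case_option [computable_intros]:
  assumes "computable f" "computable a" "computable (\<lambda>p. b (fst p) (snd p))"
  shows "computable (\<lambda>x. case f x of None \<Rightarrow> a x | Some y \<Rightarrow> b x y)"
proof -
  obtain f' where f: "loop_computable f'" "\<And>x. f' (enc x) = enc (f x)" using assms(1) unfolding computable_def by blast
  obtain a' where a: "loop_computable a'" "\<And>x. a' (enc x) = enc (a x)" using assms(2) unfolding computable_def by blast
  obtain b' where b: "loop_computable b'" "\<And>p. b' (enc p) = enc (b (fst p) (snd p))"
    using assms(3) unfolding computable_def by blast
  have b'': "b' (prod_encode (enc x, enc y)) = enc (b x y)" for x y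
    using b(2)[of "(x, y)"] by (simp add: enc_prod_def)
  show ?thesis
    by (rule computableI[OF loop_computable_if_zero[OF f(1) a(1) loop_computable_comp[OF b(1) loop_computable_pair[OF loop_computable_id loop_computable_pred[OF f(1)]]]]])
      (auto simp: f(2) a(2) b'' enc_option_def split: option.splits)
qed

lemma computable_Some [computable_intros]:
  assumes "computable f"
  shows "computable (\<lambda>x. Some (f x))"
proof -
  obtain f' where f: "loop_computable f'" "\<And>x. f' (enc x) = enc (f x)" using assms(1) unfolding computable_def by blast
  show ?thesis by (rule computableI[OF loop_computable_comp[OF loop_computable_Suc f(1)]]) (simp add: f enc_option_def)
qed

lemma computable_Cons [computable_intros]:
  assumes "computable f" "computable g"
  shows "computable (\<lambda>x. f x # g x)"
proof -
  obtain h where h: "loop_computable h" "\<And>x. h (enc x) = enc (f x, g x)"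
    using computable_Pair[OF assms] unfolding computable_def by blast
  show ?thesis
    by (rule computableI[OF loop_computable_comp[OF loop_computable_Suc h(1)]]) (simp add: h enc_list_def enc_prod_def)
qed

lemma computable_case_list [computable_intros]:
  assumes "computable f" "computable a" "computable (\<lambda>p. b (fst p) (fst (snd p)) (snd (snd p)))"
  shows "computable (\<lambda>x. case f x of [] \<Rightarrow> a x | y # ys \<Rightarrow> b x y ys)"
proof -
  obtain f' where f: "loop_computable f'" "\<And>x. f' (enc x) = enc (f x)" using assms(1) unfolding computable_def by blast
  obtain a' where a: "loop_computable a'" "\<And>x. a' (enc x) = enc (a x)" using assms(2) unfolding computable_def by blast
  obtain b' where b: "loop_computable b'" "\<And>p. b' (enc p) = enc (b (fst p) (fst (snd p)) (snd (snd p)))"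
    using assms(3) unfolding computable_def by blast
  have b'': "b' (prod_encode (enc x, prod_encode (enc y, list_encode (map enc ys)))) = enc (b x y ys)"
    for x y ys
    using b(2)[of "(x, y, ys)"] by (simp add: enc_prod_def enc_list_def)
  show ?thesis
    by (rule computableI[OF loop_computable_if_zero[OF f(1) a(1) loop_computable_comp[OF b(1) loop_computable_pair[OF loop_computable_id loop_computable_pred[OF f(1)]]]]])
      (auto simp: f(2) a(2) b'' enc_list_def split: list.splits)
qed

text \<open>Supplies a computable number of rounds that suffices to traverse a list.\<close>

lemma length_le_enc: "length xs \<le> enc xs"
proof (induction xs)
  case (Cons x xs)
  then show ?case
    using le_prod_encode_2[of "enc xs" "enc x"] by (simp add: enc_list_def)
qed simp

lemma computable_fold [computable_intros]:
  assumes "computable (\<lambda>p. g (fst p) (fst (snd p)) (snd (snd p)))" "computable l" "computable a"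
  shows "computable (\<lambda>x. fold (g x) (l x) (a x))"
proof -
  \<comment> \<open>The state is the list still to be traversed with the accumulator; once the list
    is empty, further rounds change nothing.\<close>
  let ?h = "\<lambda>x p. case fst p of [] \<Rightarrow> p | y # ys \<Rightarrow> (ys, g x y (snd p))"
  have "computable (\<lambda>p. g (fst (fst p)) (fst (snd p)) (snd (snd (fst p))))"
    using computable_comp[OF assms(1), of "\<lambda>p. (fst (fst p), fst (snd p), snd (snd (fst p)))"]
    by (simp add: computable_intros)
  then have "computable (\<lambda>x. snd ((?h x ^^ enc (l x)) (l x, a x)))"
    by (intro computable_intros assms)
  moreover have "snd ((?h x ^^ n) (ys, b)) = fold (g x) ys b" if "length ys \<le> n" for x n ys b
    using that
  proof (induction n arbitrary: ys b)
    case (Suc n)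
    have "?h x ([], b) = ([], b)" for b by simp
    then have "(?h x ^^ n) ([], b) = ([], b)" by (induction n) auto
    with Suc show ?case
      by (cases ys) (auto simp: funpow_Suc_right simp del: funpow.simps)
  qed simp
  ultimately show ?thesis by (simp add: length_le_enc)
qed

section \<open>Simulation of machines\<close>

text \<open>The encodings of pairs and lists of numbers invert \<open>prod_decode\<close> and
  \<open>list_decode\<close>, so on codes the decoding is the identity.\<close>

lemma computable_prod_decode [computable_intros]: "computable f \<Longrightarrow> computable (\<lambda>x. prod_decode (f x))"
  by (rule computable_comp[of prod_decode], rule computableI[OF loop_computable_id]) (simp_all add: enc_prod_def enc_nat_def)

lemma computable_list_decode [computable_intros]: "computable f \<Longrightarrow> computable (\<lambda>x. list_decode (f x))"
proof (rule computable_comp[of list_decode], rule computableI[OF loop_computable_id])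
  show "enc x = enc (list_decode x)" for x :: nat
    by (simp add: enc_list_def enc_nat_def[abs_def])
qed

lemma computable_case_prod [computable_intros]:
  "computable (\<lambda>x. f x (fst (p x)) (snd (p x))) \<Longrightarrow> computable (\<lambda>x. case p x of (a, b) \<Rightarrow> f x a b)"
  by (simp add: case_prod_beta)

lemma computable_Let [computable_intros]: "computable (\<lambda>x. f x (a x)) \<Longrightarrow> computable (\<lambda>x. let y = a x in f x y)"
  by simp

lemma computable_rev [computable_intros]: "computable f \<Longrightarrow> computable (\<lambda>x. rev (f x))"
  unfolding rev_conv_fold by (intro computable_intros)

lemma computable_append [computable_intros]:
  assumes "computable f" "computable g"
  shows "computable (\<lambda>x. f x @ g x)"
proof -
  have "computable (\<lambda>x. fold (#) (rev (f x)) (g x))" by (intro computable_intros assms)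
  then show ?thesis by (simp add: fold_Cons_rev)
qed

lemma fold_Cons_map: "fold (\<lambda>y acc. h y # acc) ys acc = rev (map h ys) @ acc"
  by (induction ys arbitrary: acc) auto

lemma computable_map [computable_intros]:
  assumes "computable (\<lambda>p. g (fst p) (snd p))" "computable l"
  shows "computable (\<lambda>x. map (g x) (l x))"
proof -
  have "computable (\<lambda>p. g (fst p) (fst (snd p)))"
    using computable_comp[OF assms(1), of "\<lambda>p. (fst p, fst (snd p))"] by (simp add: computable_intros)
  then have "computable (\<lambda>x. rev (fold (\<lambda>y acc. g x y # acc) (l x) []))"
    by (intro computable_intros assms)
  then show ?thesis by (simp add: fold_Cons_map)
qed

lemma fold_find: "fold (\<lambda>y acc. if acc = None \<and> Q y then Some y else acc) ys None = find Q ys"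
proof -
  have "fold (\<lambda>y acc. if acc = None \<and> Q y then Some y else acc) ys (Some z) = Some z" for z ys
    by (induction ys) auto
  then show ?thesis by (induction ys) auto
qed

lemma computable_find [computable_intros]:
  assumes "computable (\<lambda>p. P (fst p) (snd p))" "computable l"
  shows "computable (\<lambda>x. find (P x) (l x))"
proof -
  have "computable (\<lambda>p. P (fst p) (fst (snd p)))"
    using computable_comp[OF assms(1), of "\<lambda>p. (fst p, fst (snd p))"] by (simp add: computable_intros)
  then have "computable (\<lambda>x. fold (\<lambda>y acc. if acc = None \<and> P x y then Some y else acc) (l x) None)"
    by (intro computable_intros assms)
  then show ?thesis by (simp only: fold_find)
qed

lemma fold_zip:
  "rev (snd (fold (\<lambda>a p. case fst p of [] \<Rightarrow> p | b # bs \<Rightarrow> (bs, (a, b) # snd p)) as (bs, acc))) =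
     rev acc @ zip as bs"
  by (induction as arbitrary: bs acc) (auto split: list.splits)

lemma computable_zip [computable_intros]:
  assumes "computable f" "computable g"
  shows "computable (\<lambda>x. zip (f x) (g x))"
proof -
  have "computable (\<lambda>x. rev (snd (fold (\<lambda>a p. case fst p of [] \<Rightarrow> p | b # bs \<Rightarrow> (bs, (a, b) # snd p))
      (f x) (g x, []))))"
    by (intro computable_intros assms)
  then show ?thesis by (simp add: fold_zip)
qed

lemma computable_tl [computable_intros]: "computable f \<Longrightarrow> computable (\<lambda>x. tl (f x))"
  unfolding tl_def by (intro computable_intros)

lemma computable_first_sym [computable_intros]:
  assumes "computable f"
  shows "computable (\<lambda>x. first_sym (f x))"
proof -
  have "computable (\<lambda>x. case f x of [] \<Rightarrow> 0 | y # ys \<Rightarrow> y)" by (intro computable_intros assms)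
  moreover have "first_sym xs = (case xs of [] \<Rightarrow> 0 | y # ys \<Rightarrow> y)" for xs
    by (simp split: list.splits)
  ultimately show ?thesis by simp
qed

lemma funpow_Cons: "((\<lambda>ys. z # ys) ^^ n) [] = replicate n z"
  by (induction n) auto

lemma computable_replicate [computable_intros]:
  assumes "computable f" "computable g"
  shows "computable (\<lambda>x. replicate (f x) (g x))"
proof -
  have "computable (\<lambda>x. ((\<lambda>ys. g x # ys) ^^ f x) [])"
    by (intro computable_intros assms assms[THEN computable_comp])
  then show ?thesis by (simp add: funpow_Cons)
qed

lemma funpow_tl: "(tl ^^ n) xs = drop n xs"
  by (induction n) (auto simp: drop_Suc tl_drop)

lemma computable_drop [computable_intros]:
  assumes "computable f" "computable g"
  shows "computable (\<lambda>x. drop (f x) (g x))"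
proof -
  have "computable (\<lambda>x. (tl ^^ f x) (g x))"
    by (intro computable_intros assms)
  then show ?thesis by (simp add: funpow_tl)
qed

section \<open>Encodings of rules and configurations\<close>

instantiation unit :: enc
begin
definition enc_unit :: "unit \<Rightarrow> nat" where "enc_unit x = 0"
instance by standard simp
end

text \<open>Closed records are the schemes extended by \<open>unit\<close>, so the extension is
  encoded as a further component.\<close>

instantiation rule_ext :: (enc) enc
begin
definition enc_rule_ext :: "'a rule_scheme \<Rightarrow> nat" where
  "enc_rule_ext r =
     enc (r_state r, r_input r, r_work r, r_next r, r_advance r, r_emit r, rule.more r)"
instance by standard (simp add: enc_rule_ext_def enc_eq_iff)
end

instantiation config_ext :: (enc) enc
begin
definition enc_config_ext :: "'a config_scheme \<Rightarrow> nat" where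
  "enc_config_ext c = enc (state c, pos c, tapes c, out c, config.more c)"
instance by standard (simp add: enc_config_ext_def enc_eq_iff)
end

lemma computable_rule_sel [computable_intros]:
  fixes f :: "'a::enc \<Rightarrow> rule"
  assumes "computable f"
  shows "computable (\<lambda>x. r_state (f x))" "computable (\<lambda>x. r_input (f x))" "computable (\<lambda>x. r_work (f x))"
    "computable (\<lambda>x. r_next (f x))" "computable (\<lambda>x. r_advance (f x))" "computable (\<lambda>x. r_emit (f x))"
proof -
  have "computable (\<lambda>r :: rule. (r_state r, r_input r, r_work r, r_next r, r_advance r, r_emit r, rule.more r))"
    by (rule computableI[OF loop_computable_id]) (simp add: enc_rule_ext_def)
  note t = computable_comp[OF this assms]
  note s = computable_snd[OF t] computable_snd[OF computable_snd[OF t]] computable_snd[OF computable_snd[OF computable_snd[OF t]]]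
    computable_snd[OF computable_snd[OF computable_snd[OF computable_snd[OF t]]]]
    computable_snd[OF computable_snd[OF computable_snd[OF computable_snd[OF computable_snd[OF t]]]]]
  show "computable (\<lambda>x. r_state (f x))" using computable_fst[OF t] by simp
  show "computable (\<lambda>x. r_input (f x))" using computable_fst[OF s(1)] by simp
  show "computable (\<lambda>x. r_work (f x))" using computable_fst[OF s(2)] by simp
  show "computable (\<lambda>x. r_next (f x))" using computable_fst[OF s(3)] by simp
  show "computable (\<lambda>x. r_advance (f x))" using computable_fst[OF s(4)] by simp
  show "computable (\<lambda>x. r_emit (f x))" using computable_fst[OF s(5)] by simp
qed

lemma computable_rule [computable_intros]:
  assumes "computable a" "computable b" "computable c" "computable d" "computable e" "computable f"
  shows "computable (\<lambda>x. \<lparr>r_state = a x, r_input = b x, r_work = c x, r_next = d x, r_advance = e x,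
    r_emit = f x\<rparr>)"
proof -
  have "computable (\<lambda>x. (a x, b x, c x, d x, e x, f x, ()))" by (intro computable_intros assms)
  then show ?thesis by (simp add: computable_def enc_rule_ext_def)
qed

lemma computable_config_sel [computable_intros]:
  fixes f :: "'a::enc \<Rightarrow> config"
  assumes "computable f"
  shows "computable (\<lambda>x. state (f x))" "computable (\<lambda>x. pos (f x))" "computable (\<lambda>x. tapes (f x))" "computable (\<lambda>x. out (f x))"
proof -
  have "computable (\<lambda>c :: config. (state c, pos c, tapes c, out c, config.more c))"
    by (rule computableI[OF loop_computable_id]) (simp add: enc_config_ext_def)
  note t = computable_comp[OF this assms]
  note s = computable_snd[OF t] computable_snd[OF computable_snd[OF t]] computable_snd[OF computable_snd[OF computable_snd[OF t]]]
  show "computable (\<lambda>x. state (f x))" using computable_fst[OF t] by simp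
  show "computable (\<lambda>x. pos (f x))" using computable_fst[OF s(1)] by simp
  show "computable (\<lambda>x. tapes (f x))" using computable_fst[OF s(2)] by simp
  show "computable (\<lambda>x. out (f x))" using computable_fst[OF s(3)] by simp
qed

lemma computable_config [computable_intros]:
  assumes "computable a" "computable b" "computable c" "computable d"
  shows "computable (\<lambda>x. \<lparr>state = a x, pos = b x, tapes = c x, out = d x\<rparr>)"
proof -
  have "computable (\<lambda>x. (a x, b x, c x, d x, ()))" by (intro computable_intros assms)
  then show ?thesis by (simp add: computable_def enc_config_ext_def)
qed

lemma computable_decode_rule [computable_intros]: "computable f \<Longrightarrow> computable (\<lambda>x. decode_rule (f x))"
  unfolding decode_rule_def decode_work_def decode_move_def decode_emit_def
  by (intro computable_intros)

lemma computable_rules [computable_intros]: "computable f \<Longrightarrow> computable (\<lambda>x. rules (decode_machine (f x)))"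
  by (simp add: decode_machine_def case_prod_beta computable_intros)

lemma computable_init [computable_intros]: "computable f \<Longrightarrow> computable (\<lambda>x. init (decode_machine (f x)))"
  by (simp add: init_def decode_machine_def case_prod_beta computable_intros)

lemma tape_op_eq:
  "tape_op w T =
     (if snd (snd w) = Stay then (fst T, fst (snd w) # tl (snd T))
      else if snd (snd w) = Left then (tl (fst T), first_sym (fst T) # fst (snd w) # tl (snd T))
      else (fst (snd w) # fst T, tl (snd T)))"
  by (cases "(w, T)" rule: tape_op.cases) auto

lemma computable_tape_op [computable_intros]:
  assumes "computable f" "computable g"
  shows "computable (\<lambda>x. tape_op (f x) (g x))"
  unfolding tape_op_eq by (intro computable_intros assms)

lemma computable_scanned [computable_intros]:
  assumes "computable f"
  shows "computable (\<lambda>x. scanned (f x))"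
proof -
  have "computable (\<lambda>x. first_sym (snd (f x)))" by (intro computable_intros assms)
  moreover have "first_sym (snd T) = scanned T" for T by (cases T) simp
  ultimately show ?thesis by simp
qed

text \<open>The core of the universal machine: iterated by \<open>computable_funpow\<close>, it
  simulates every machine from its Goedel number.\<close>

lemma computable_step [computable_intros]:
  assumes "computable e" "computable n" "computable c"
  shows "computable (\<lambda>x. step (decode_machine (e x)) (nat_input (n x)) (c x))"
proof -
  \<comment> \<open>\<open>D\<close> serves the goals below a bound variable, where the parameters
    are applied to a projection of a pair.\<close>
  note D = assms[THEN computable_comp]
  show ?thesis
    unfolding step_def applicable_def apply_rule_def nat_input_def
    by (intro computable_intros D assms)
qed

section \<open>The separating function\<close>

text \<open>Input and time are packed into one number, so that a certificate can be an entry of a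
  point of Baire space. As the time is part of it, the test is decidable.\<close>

definition emits :: "nat \<Rightarrow> nat \<Rightarrow> bool" where
  "emits e z \<longleftrightarrow>
     (case prod_decode z of (n, t) \<Rightarrow> out (run (decode_machine e) (nat_input n) t) \<noteq> [])"

lemma computable_emits [computable_intros]:
  assumes "computable e" "computable z"
  shows "computable (\<lambda>x. emits (e x) (z x))"
  unfolding emits_def run_def by (intro computable_intros assms assms[THEN computable_comp])

section \<open>Names of the two points and their certificates\<close>

lemma type2_name_Bot: "type2_name p Bot \<longleftrightarrow> range p = {0}"
proof -
  have "{i. i < length sierpinski_base \<and> Bot \<in> sierpinski_base ! i} = {0}"
    by (auto simp: sierpinski_base_def less_Suc_eq)
  then show ?thesis by (simp add: type2_name_def)
qed

lemma type2_name_Top: "type2_name p Top \<longleftrightarrow> range p = {0, 1}"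
proof -
  have "{i. i < length sierpinski_base \<and> Top \<in> sierpinski_base ! i} = {0, 1}"
    by (auto simp: sierpinski_base_def less_Suc_eq)
  then show ?thesis by (simp add: type2_name_def)
qed

lemma run_halted:
  assumes "halted M inp (run M inp t)"
  shows "run M inp (t + d) = run M inp t"
proof (induction d)
  case (Suc d)
  then show ?case using assms by (simp add: run_def step_def halted_def)
qed simp

text \<open>A name of \<open>Bot\<close> has only the value 0, whose unary notation is the empty
  word. Before halting the output is a prefix of it, afterwards it does not change.\<close>

lemma not_emits_Bot:
  assumes "markov_name e Bot"
  shows "\<not> emits e z"
proof -
  obtain n t where z: "prod_decode z = (n, t)" by force
  obtain p where p: "computes (decode_machine e) p" "range p = {0}"
    using assms by (auto simp: markov_name_def type2_name_Bot)
  let ?run = "run (decode_machine e) (nat_input n)"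
  have "p n = 0" using p(2) by auto
  then obtain t' where t': "halted (decode_machine e) (nat_input n) (?run t')" "out (?run t') = []"
    using p(1)[unfolded computes_def, rule_format, of n] by auto
  have "out (?run t) = []"
  proof (cases "t \<le> t'")
    case True
    then show ?thesis using out_run_mono[OF True] t'(2) by (metis append_is_Nil_conv)
  next
    case False
    then show ?thesis using run_halted[OF t'(1), of "t - t'"] t'(2) by simp
  qed
  then show ?thesis by (simp add: emits_def z)
qed

text \<open>A name of \<open>Top\<close> takes the value 1 somewhere, and there the machine writes a
  one.\<close>

lemma emits_Top:
  assumes "markov_name e Top"
  shows "\<exists>z. emits e z"
proof -
  obtain p where p: "computes (decode_machine e) p" "range p = {0, 1}"
    using assms by (auto simp: markov_name_def type2_name_Top)
  then have "1 \<in> range p" by simp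
  then obtain n where "p n = 1" by (metis imageE)
  then obtain t where "out (run (decode_machine e) (nat_input n) t) = [True]"
    using p(1)[unfolded computes_def, rule_format, of n] by auto
  then have "emits e (prod_encode (n, t))" by (simp add: emits_def)
  then show ?thesis ..
qed

text \<open>The prefix with code \<open>c\<close> is long enough to show that its entry at \<open>e\<close> is no certificate for \<open>e\<close>.\<close>

definition passes :: "nat \<Rightarrow> nat \<Rightarrow> bool" where
  "passes e c \<longleftrightarrow> (case drop e (list_decode c) of [] \<Rightarrow> False | z # zs \<Rightarrow> \<not> emits e z)"

lemma passes_iff:
  "passes e c \<longleftrightarrow> e < length (list_decode c) \<and> \<not> emits e (list_decode c ! e)"
  by (cases "e < length (list_decode c)")
    (simp_all add: passes_def Cons_nth_drop_Suc[symmetric])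

text \<open>Built from cylinders rather than points, so that openness and the comparison with a
  listing are immediate.\<close>

definition top_set :: "(nat \<Rightarrow> nat) set" where
  "top_set = (\<Union>c\<in>{c. \<exists>e. passes e c \<and> (\<exists>z. emits e z)}. cylinder (list_decode c))"

text \<open>The diagonal point: its entry is a certificate at every \<open>e\<close> that has one,
  and only such \<open>e\<close> contribute cylinders to \<open>top_set\<close>.\<close>

lemma certificate_notin_top_set: "(\<lambda>e. SOME z. emits e z) \<notin> top_set"
proof
  assume "(\<lambda>e. SOME z. emits e z) \<in> top_set"
  then obtain e c where "(\<lambda>e. SOME z. emits e z) \<in> cylinder (list_decode c)"
    and c: "passes e c" "\<exists>z. emits e z"
    by (auto simp: top_set_def)
  then have "list_decode c ! e = (SOME z. emits e z)"
    by (auto simp: passes_iff cylinder_def)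
  then have "emits e (list_decode c ! e)" using someI_ex[OF c(2)] by simp
  then show False using c(1) by (simp add: passes_iff)
qed

lemma open_cylinder: "open (cylinder u)"
proof -
  have "cylinder u = (\<Inter>i<length u. (\<lambda>x. x i) -` {u ! i})"
    by (auto simp: cylinder_def)
  moreover have "open ((\<lambda>x :: nat \<Rightarrow> nat. x i) -` {a})" for i a
    by (intro open_vimage open_discrete) simp
  ultimately show ?thesis by (simp add: open_INT)
qed

lemma open_top_set: "open top_set"
  unfolding top_set_def by (auto intro!: open_UN open_cylinder)

section \<open>Markov-computability of the separating function\<close>

primrec sep_fun :: "sierpinski \<Rightarrow> (nat \<Rightarrow> nat) set" where
  "sep_fun Bot = UNIV"
| "sep_fun Top = top_set"

text \<open>At time 0 nothing has been written, so the pair of zeros is never a certificate and a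
  constant prefix reaching position \<open>e\<close> passes.\<close>

lemma ex_default_code: "\<exists>c. passes e c"
proof -
  have "\<not> emits e (prod_encode (0, 0))" by (simp add: emits_def run_def init_def)
  then have "passes e (list_encode (replicate (Suc e) (prod_encode (0, 0))))"
    by (simp add: passes_iff del: replicate_Suc)
  then show ?thesis ..
qed

text \<open>
  A stage \<open>s\<close> consists of a code \<open>c\<close>, a program \<open>e'\<close> and possible certificates for \<open>e\<close> and \<open>e'\<close>.
  A stage without a result lists the code \<open>d\<close> of some cylinder inside \<^const>\<open>top_set\<close>.
\<close>

definition enum_fun :: "nat \<Rightarrow> nat \<Rightarrow> nat \<Rightarrow> nat" where
  "enum_fun d e s = (case prod_decode s of (c, s1) \<Rightarrow> case prod_decode s1 of (e', s2) \<Rightarrow>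
     case prod_decode s2 of (z, z') \<Rightarrow>
     if passes e' c \<and> (e' = e \<or> emits e z \<and> emits e' z') then c else d)"

lemma enum_fun_encode:
  "enum_fun d e (prod_encode (c, prod_encode (e', prod_encode (z, z')))) =
     (if passes e' c \<and> (e' = e \<or> emits e z \<and> emits e' z') then c else d)"
  by (simp add: enum_fun_def)

lemma range_enum_fun:
  "range (enum_fun d e) \<subseteq>
     insert d {c. \<exists>e'. passes e' c \<and> (e' = e \<or> (\<exists>z. emits e z) \<and> (\<exists>z. emits e' z))}"
  by (auto simp: enum_fun_def split: prod.splits; blast)

lemma computable_enum_fun: "computable (\<lambda>p. enum_fun d (fst p) (snd p))"
  unfolding enum_fun_def passes_def by (intro computable_intros)

lemma markov_computable_sep_fun: "markov_computable sep_fun"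
proof -
  \<comment> \<open>\<open>d\<close> is listed for both points. It passes for a program with
    certificates, so its cylinder lies inside \<open>top_set\<close>.\<close>
  obtain e0 where "markov_name e0 Top" using ex_markov_name_Top by blast
  then obtain d where d: "passes e0 d" "\<exists>z. emits e0 z"
    using ex_default_code emits_Top by blast
  obtain f where f: "loop_computable f" "\<And>e s. f (prod_encode (e, s)) = enum_fun d e s"
  proof -
    obtain f where f: "loop_computable f" "\<forall>p. f (enc p) = enc (enum_fun d (fst p) (snd p))"
      using computable_enum_fun[of d] unfolding computable_def by blast
    then have "f (prod_encode (e, s)) = enum_fun d e s" for e s
      using f(2)[rule_format, of "(e, s)"] by (simp add: enc_prod_def enc_nat_def)
    then show ?thesis by (rule that[OF f(1)])
  qed
  obtain M where M: "\<And>e. enumerates M (nat_input e) = range (enum_fun d e)"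
    using loop_computable_enumerable[OF f(1)] f(2) by auto
  have "outputs_open M (nat_input e) (sep_fun s)" if e: "markov_name e s" for s e
  proof (cases s)
    case Bot
    have "y \<in> (\<Union>c\<in>range (enum_fun d e). cylinder (list_decode c))" for y
    proof -
      \<comment> \<open>The shortest prefix of \<open>y\<close> that shows its entry at
        \<open>e\<close>, which is no certificate since \<open>e\<close> has none.\<close>
      let ?c = "list_encode (map y [0..<Suc e])"
      have "passes e ?c"
        using not_emits_Bot[OF e[unfolded Bot]] by (simp add: passes_iff del: upt_Suc)
      then have "enum_fun d e (prod_encode (?c, prod_encode (e, prod_encode (0, 0)))) = ?c"
        by (simp add: enum_fun_encode)
      then have "?c \<in> range (enum_fun d e)" by (rule range_eqI[OF sym])
      moreover have "y \<in> cylinder (list_decode ?c)"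
        by (simp add: cylinder_def del: upt_Suc)
      ultimately show ?thesis by blast
    qed
    then show ?thesis using Bot by (auto simp: outputs_open_def M)
  next
    case Top
    then have Te: "\<exists>z. emits e z" using emits_Top e by simp
    have "(\<Union>c\<in>range (enum_fun d e). cylinder (list_decode c)) \<subseteq> top_set"
    proof (rule UN_least)
      fix c assume "c \<in> range (enum_fun d e)"
      from subsetD[OF range_enum_fun this]
      have "c = d \<or> (\<exists>e'. passes e' c \<and> (e' = e \<or> (\<exists>z. emits e' z)))" by auto
      \<comment> \<open>For \<open>e' = e\<close> the certificate exists because \<open>e\<close>
        names \<open>Top\<close>; for \<open>c = d\<close> it is that of \<open>e0\<close>.\<close>
      then have "\<exists>e'. passes e' c \<and> (\<exists>z. emits e' z)"
        using Te d by metis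
      then show "cylinder (list_decode c) \<subseteq> top_set"
        unfolding top_set_def by (intro UN_upper) simp
    qed
    moreover have "top_set \<subseteq> (\<Union>c\<in>range (enum_fun d e). cylinder (list_decode c))"
    proof
      fix y assume "y \<in> top_set"
      then obtain e' c z' where c: "passes e' c" "emits e' z'" "y \<in> cylinder (list_decode c)"
        by (auto simp: top_set_def)
      \<comment> \<open>A certificate for \<open>e\<close> opens the listing to all other programs
        that have certificates.\<close>
      obtain z where "emits e z" using Te by blast
      with c have "enum_fun d e (prod_encode (c, prod_encode (e', prod_encode (z, z')))) = c"
        by (simp add: enum_fun_encode)
      then have "c \<in> range (enum_fun d e)" by (rule range_eqI[OF sym])
      with c(3) show "y \<in> (\<Union>c\<in>range (enum_fun d e). cylinder (list_decode c))" by blast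
    qed
    ultimately show ?thesis using Top by (simp add: outputs_open_def M)
  qed
  then show ?thesis unfolding markov_computable_def by blast
qed

section \<open>Finite use of the input and failure of K-computability\<close>

lemma run_cong:
  assumes "\<And>i. i < t \<Longrightarrow> inp i = inp' i"
  shows "run M inp t = run M inp' t"
proof -
  \<comment> \<open>The head advances at most one cell per step, so each of the first
    \<open>t\<close> steps reads a cell below \<open>t\<close>.\<close>
  have "run M inp u = run M inp' u \<and> pos (run M inp u) \<le> u" if "u \<le> t" for u
    using that
  proof (induction u)
    case 0
    then show ?case by (simp add: run_def init_def)
  next
    case (Suc u)
    let ?c = "run M inp u"
    have eq: "run M inp' u = ?c" and le: "pos ?c \<le> u" using Suc by auto
    then have "applicable inp ?c = applicable inp' ?c"
      using Suc.prems assms by (auto simp: applicable_def fun_eq_iff)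
    then have "step M inp ?c = step M inp' ?c" by (simp add: step_def)
    moreover have "pos (step M inp ?c) \<le> Suc (pos ?c)"
      by (auto simp: step_def apply_rule_def split: option.splits)
    ultimately show ?case using eq le by (simp add: run_def)
  qed
  then show ?thesis by blast
qed

text \<open>The separator number \<open>n\<close> lies in cell \<open>n\<close> or later, so a cell
  up to \<open>N\<close> depends only on the separators up to \<open>N\<close>. Because
  \<open>k\<close> comes first, these involve only the entries of \<open>p\<close> below
  \<open>N\<close>.\<close>

lemma seq_input_agree:
  assumes "\<And>j. j < N \<Longrightarrow> p j = q j" "i \<le> N"
  shows "seq_input (case_nat k p) i = seq_input (case_nat k q) i"
proof -
  have "(\<Sum>j\<le>n. case_nat k p j) = (\<Sum>j\<le>n. case_nat k q j)" if "n \<le> N" for n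
    using that assms(1) by (intro sum.cong) (auto split: nat.splits)
  then have "i = n + (\<Sum>j\<le>n. case_nat k p j) \<longleftrightarrow> i = n + (\<Sum>j\<le>n. case_nat k q j)" for n
    using assms(2) by (cases "n \<le> N") auto
  then show ?thesis by (simp add: seq_input_def)
qed

lemma not_K_computable_sep_fun: "\<not> K_computable sep_fun"
proof
  assume "K_computable sep_fun"
  then obtain M where M: "\<And>s k p. K_name k p s \<Longrightarrow>
      outputs_open M (seq_input (case_nat k p)) (sep_fun s)"
    unfolding K_computable_def by blast
  obtain e1 e2 where e: "markov_name e1 Bot" "markov_name e2 Top"
    using ex_markov_name_Bot ex_markov_name_Top by blast
  \<comment> \<open>One bound for both points, so that the first component of a name does not tell
    them apart.\<close>
  define k where "k = max (program_length e1) (program_length e2)"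
  have "K Bot \<le> enat (program_length e1)" "K Top \<le> enat (program_length e2)"
    unfolding K_def using e by (auto intro: INF_lower)
  moreover have "enat (program_length e1) \<le> enat k" "enat (program_length e2) \<le> enat k"
    by (simp_all add: k_def)
  ultimately have k: "K Bot \<le> enat k" "K Top \<le> enat k"
    by (blast intro: order_trans)+
  define y where "y = (\<lambda>e. SOME z. emits e z)"
  let ?inp = "\<lambda>p. seq_input (case_nat k p)"
  have "K_name k (\<lambda>_. 0) Bot" using k by (auto simp: K_name_def type2_name_Bot)
  \<comment> \<open>The image of \<open>Bot\<close> is the whole space, so some listed cylinder
    contains \<open>y\<close>.\<close>
  from M[OF this] obtain c where "c \<in> enumerates M (?inp (\<lambda>_. 0))" "y \<in> cylinder (list_decode c)"
    by (auto simp: outputs_open_def)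
  then obtain t where t: "c \<in> set (blocks 0 (out (run M (?inp (\<lambda>_. 0)) t)))"
    and y: "y \<in> cylinder (list_decode c)"
    by (auto simp: enumerates_def)
  \<comment> \<open>The cells read within \<open>t\<close> steps depend only on entries below
    \<open>t\<close>, where \<open>?p\<close> is 0; its 1 at \<open>t\<close> makes it a name of
    \<open>Top\<close>.\<close>
  let ?p = "\<lambda>j. if j = t then 1 else 0 :: nat"
  have "range ?p = {0, 1}"
  proof
    \<comment> \<open>The witness \<open>Suc t\<close> for the value 0 also covers
      \<open>t = 0\<close>.\<close>
    have "0 = ?p (Suc t)" "1 = ?p t" by auto
    then show "{0, 1} \<subseteq> range ?p" by blast
  qed auto
  then have Top: "K_name k ?p Top" using k by (simp add: K_name_def type2_name_Top)
  have "run M (?inp (\<lambda>_. 0)) t = run M (?inp ?p) t"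
    by (intro run_cong seq_input_agree[of t]) auto
  with t have "c \<in> enumerates M (?inp ?p)"
    by (auto simp: enumerates_def)
  with M[OF Top] y have "y \<in> top_set"
    by (auto simp: outputs_open_def)
  then show False using certificate_notin_top_set by (simp add: y_def)
qed

theorem mainTheorem15:
  shows "\<exists>F :: sierpinski \<Rightarrow> (nat \<Rightarrow> nat) set.
           (\<forall>s. open (F s)) \<and> markov_computable F \<and> \<not> K_computable F"
proof (intro exI[of _ sep_fun] conjI allI)
  show "open (sep_fun s)" for s by (cases s) (simp_all add: open_top_set)
qed (rule markov_computable_sep_fun not_K_computable_sep_fun)+

end
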